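(* Fix any $\varepsilon,\delta>0$ and sets $Q,P\subset\mathbb{R}^d$ of unit vectors, and let $m=|Q|+|P|$. Set $$k_{\mathrm{sim}}=O\!\left(\frac{\log(m\,\varepsilon^{-1}\delta^{-1})}{\varepsilon^2}\right),\qquad d_{\mathrm{proj}}=O\!\left(\frac{1}{\varepsilon^2}\log\Big(\frac{m}{\varepsilon\delta}\Big)\right),\qquad R_{\mathrm{reps}}=1,$$ so that $d_{\mathrm{FDE}}=\left(\frac{m}{\varepsilon\delta}\right)^{O(1/\varepsilon^2)}$. Let $\mathbf{F}_{\mathrm{q}}(Q),\mathbf{F}_{\mathrm{doc}}(P)\in\mathbb{R}^{d_{\mathrm{FDE}}}$ be the (random) query and document fixed dimensional encodings with these parameters. Then, in expectation and with probability at least $1-\delta$, $$\mathrm{NChamfer}(Q,P)-\varepsilon\;\le\;\frac{1}{|Q|}\langle \mathbf{F}_{\mathrm{q}}(Q),\mathbf{F}_{\mathrm{doc}}(P)\rangle\;\le\;\mathrm{NChamfer}(Q,P)+\varepsilon .$$ (Here "in expectation" means that the two inequalities hold with the middle quantity replaced by its expected value.)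
   Context: All sets of vectors are finite and nonempty. Chamfer similarity: for $Q,P\subset\mathbb{R}^d$, $\mathrm{Chamfer}(Q,P)=\sum_{q\in Q}\max_{p\in P}\langle q,p\rangle$ and $\mathrm{NChamfer}(Q,P)=\frac{1}{|Q|}\mathrm{Chamfer}(Q,P)$. Fixed dimensional encodings (FDEs): the parameters are positive integers $k_{\mathrm{sim}},d_{\mathrm{proj}},R_{\mathrm{reps}}$; put $B=2^{k_{\mathrm{sim}}}$ and identify the $B$ clusters with the bit strings in $\{0,1\}^{k_{\mathrm{sim}}}$. Partition (SimHash): sample random Gaussian vectors $g_1,\dots,g_{k_{\mathrm{sim}}}\in\mathbb{R}^d$ and let $\varphi(x)=(\mathbf{1}(\langle g_1,x\rangle>0),\dots,\mathbf{1}(\langle g_{k_{\mathrm{sim}}},x\rangle>0))\in\{0,1\}^{k_{\mathrm{sim}}}$. Blocks: for each cluster $k$, the query block is $\vec q_{(k)}=\sum_{q\in Q,\ \varphi(q)=k}q$ (the zero vector if no such $q$ exists). The document block $\vec p_{(k)}$ is the average $\frac{1}{|P\cap\varphi^{-1}(k)|}\sum_{p\in P,\ \varphi(p)=k}p$ if $P\cap\varphi^{-1}(k)\neq\emptyset$; if $P\cap\varphi^{-1}(k)=\emptyset$, then $\vec p_{(k)}=p$ for a point $p\in P$ minimizing the Hamming distance between $\varphi(p)$ and $k$, with ties broken arbitrarily. Empty clusters are filled in this way for documents only, never for queries. Inner projection: $\psi:\mathbb{R}^d\to\mathbb{R}^{d_{\mathrm{proj}}}$ is $\psi(x)=\frac{1}{\sqrt{d_{\mathrm{proj}}}}Sx$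 with $S\in\mathbb{R}^{d_{\mathrm{proj}}\times d}$ a random matrix with independent uniformly distributed $\pm1$ entries; when $d_{\mathrm{proj}}=d$, $\psi$ is instead the identity. The vectors $\vec q_\psi$ and $\vec p_\psi$ are the concatenations over all clusters $k$ of $\psi(\vec q_{(k)})$ and of $\psi(\vec p_{(k)})$, respectively. Repetitions: this is repeated $R_{\mathrm{reps}}$ times independently, with partitions $\varphi_i$ and projections $\psi_i$ (the same ones being used for queries and documents), and $\mathbf{F}_{\mathrm{q}}(Q)$, $\mathbf{F}_{\mathrm{doc}}(P)$ are the concatenations of the resulting $R_{\mathrm{reps}}$ vectors, in $\mathbb{R}^{d_{\mathrm{FDE}}}$ with $d_{\mathrm{FDE}}=B\cdot d_{\mathrm{proj}}\cdot R_{\mathrm{reps}}$. Setting a parameter equal to $O(f)$ means setting it to $Cf$ (rounded up to an integer) for a sufficiently large absolute constant $C$. Probability and expectation are over the random choices of the partitions and projections.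
   Formalization: The claim is proved for 0 < ε ≤ 1 and 0 < δ ≤ 1 rather than for any ε, δ > 0; for unrestricted ε, δ it fails for every absolute constant C, or the parameters are not positive integers (when m ≤ εδ). *)

theory Defs
  imports "HOL-Probability.Probability" "Jordan_Normal_Form.Matrix"
begin

unbundle no inner_syntax

hide_type (open) Finite_Cartesian_Product.vec
hide_const (open) Finite_Cartesian_Product.vec

text \<open>The dimension has to be quantified inside the statement (the constants must not depend on
  it), so vectors of \<open>\<real>\<^sup>d\<close> are elements of \<^term>\<open>carrier_vec d :: real vec set\<close>.\<close>

definition unit_vec_set :: "nat \<Rightarrow> real vec set \<Rightarrow> bool" where
  "unit_vec_set d X \<longleftrightarrow>
     finite X \<and> X \<noteq> {} \<and> X \<subseteq> carrier_vec d \<and> (\<forall>x\<in>X. sqrt (x \<bullet> x) = 1)"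

definition chamfer :: "real vec set \<Rightarrow> real vec set \<Rightarrow> real" where
  "chamfer Q P = (\<Sum>q\<in>Q. Max ((\<lambda>p. q \<bullet> p) ` P))"

definition nchamfer :: "real vec set \<Rightarrow> real vec set \<Rightarrow> real" where
  "nchamfer Q P = chamfer Q P / real (card Q)"

type_synonym array = "nat \<times> nat \<Rightarrow> real"

text \<open>The randomness of one repetition is a pair \<open>(g, s)\<close>: \<open>g (i, j)\<close> is the \<open>j\<close>-th coordinate of
  the \<open>i\<close>-th Gaussian vector and \<open>s\<close> holds the entries of the sign matrix.\<close>

definition gauss_space :: "nat \<Rightarrow> nat \<Rightarrow> array measure" where
  "gauss_space k d = PiM ({..<k} \<times> {..<d}) (\<lambda>_. density lborel std_normal_density)"

definition sign_space :: "nat \<Rightarrow> nat \<Rightarrow> array measure" where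
  "sign_space D d = PiM ({..<D} \<times> {..<d}) (\<lambda>_. measure_pmf (pmf_of_set {-1, 1}))"

definition fde_space :: "nat \<Rightarrow> nat \<Rightarrow> nat \<Rightarrow> nat \<Rightarrow> (nat \<Rightarrow> array \<times> array) measure" where
  "fde_space k D R d = PiM {..<R} (\<lambda>_. gauss_space k d \<Otimes>\<^sub>M sign_space D d)"

text \<open>Clusters are the Boolean lists of length \<open>k\<close>.\<close>

definition clusters :: "nat \<Rightarrow> bool list list" where
  "clusters k = List.n_lists k [False, True]"

definition simhash :: "nat \<Rightarrow> nat \<Rightarrow> array \<Rightarrow> real vec \<Rightarrow> bool list" where
  "simhash k d g x = map (\<lambda>i. vec d (\<lambda>j. g (i, j)) \<bullet> x > 0) [0..<k]"

definition hamming :: "bool list \<Rightarrow> bool list \<Rightarrow> nat" where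
  "hamming a b = card {i. i < length a \<and> a ! i \<noteq> b ! i}"

text \<open>A tie-breaking rule provides, for repetition \<open>i\<close> and cluster \<open>b\<close>, the point that fills \<open>b\<close> if no
  document point is hashed to \<open>b\<close>. The choice among the minimizers is arbitrary and may depend
  on the whole partition; it only has to be a random variable.\<close>

definition tie_breaking ::
  "nat \<Rightarrow> nat \<Rightarrow> nat \<Rightarrow> real vec set \<Rightarrow> (nat \<Rightarrow> array \<Rightarrow> bool list \<Rightarrow> real vec) \<Rightarrow> bool" where
  "tie_breaking k R d P fill \<longleftrightarrow>
     (\<forall>i<R. \<forall>b\<in>set (clusters k).
        (\<lambda>g. fill i g b) \<in> measurable (gauss_space k d) (count_space P) \<and>
        (\<forall>g\<in>space (gauss_space k d).
           is_arg_min (\<lambda>p. hamming (simhash k d g p) b) (\<lambda>p. p \<in> P) (fill i g b)))"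

definition query_block ::
  "nat \<Rightarrow> (real vec \<Rightarrow> bool list) \<Rightarrow> real vec set \<Rightarrow> bool list \<Rightarrow> real vec" where
  "query_block d \<phi> Q b = finsum_vec TYPE(real) d (\<lambda>q. q) {q\<in>Q. \<phi> q = b}"

definition doc_block ::
  "nat \<Rightarrow> (real vec \<Rightarrow> bool list) \<Rightarrow> (bool list \<Rightarrow> real vec) \<Rightarrow> real vec set \<Rightarrow> bool list \<Rightarrow> real vec"
  where
  "doc_block d \<phi> fill P b =
     (let A = {p\<in>P. \<phi> p = b}
      in if A = {} then fill b
         else (1 / real (card A)) \<cdot>\<^sub>v finsum_vec TYPE(real) d (\<lambda>p. p) A)"

definition inner_proj :: "nat \<Rightarrow> nat \<Rightarrow> array \<Rightarrow> real vec \<Rightarrow> real vec" where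
  "inner_proj D d s x = (if D = d then x else (1 / sqrt (real D)) \<cdot>\<^sub>v (mat D d s *\<^sub>v x))"

definition concat_vec :: "real vec list \<Rightarrow> real vec" where
  "concat_vec vs = vec_of_list (concat (map list_of_vec vs))"

definition fde_query ::
  "nat \<Rightarrow> nat \<Rightarrow> nat \<Rightarrow> nat \<Rightarrow> (nat \<Rightarrow> array \<times> array) \<Rightarrow> real vec set \<Rightarrow> real vec" where
  "fde_query k D R d \<omega> Q =
     concat_vec (map (\<lambda>i. let (g, s) = \<omega> i in
       concat_vec (map (\<lambda>b. inner_proj D d s (query_block d (simhash k d g) Q b)) (clusters k)))
     [0..<R])"

definition fde_doc ::
  "nat \<Rightarrow> nat \<Rightarrow> nat \<Rightarrow> nat \<Rightarrow> (nat \<Rightarrow> array \<Rightarrow> bool list \<Rightarrow> real vec) \<Rightarrow>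
   (nat \<Rightarrow> array \<times> array) \<Rightarrow> real vec set \<Rightarrow> real vec" where
  "fde_doc k D R d fill \<omega> P =
     concat_vec (map (\<lambda>i. let (g, s) = \<omega> i in
       concat_vec (map (\<lambda>b. inner_proj D d s (doc_block d (simhash k d g) (fill i g) P b)) (clusters k)))
     [0..<R])"

definition fde_dim :: "nat \<Rightarrow> nat \<Rightarrow> nat \<Rightarrow> nat" where
  "fde_dim k D R = 2 ^ k * D * R"

lemma length_concat_const: "(\<And>x. x \<in> set xs \<Longrightarrow> length (f x) = n) \<Longrightarrow> length (concat (map f xs)) = length xs * n"
  by (induction xs) auto

lemma dim_concat_vec: "(\<And>x. x \<in> set xs \<Longrightarrow> dim_vec (f x) = n) \<Longrightarrow> dim_vec (concat_vec (map f xs)) = length xs * n"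
  by (simp add: concat_vec_def o_def length_concat_const)

lemma length_clusters: "length (clusters k) = 2 ^ k"
  by (simp add: clusters_def length_n_lists numeral_2_eq_2)

lemma dim_inner_proj: "x \<in> carrier_vec d \<Longrightarrow> dim_vec (inner_proj D d s x) = D"
  by (auto simp: inner_proj_def)

lemma fde_query_carrier:
  assumes "Q \<subseteq> carrier_vec d"
  shows "fde_query k D R d \<omega> Q \<in> carrier_vec (fde_dim k D R)"
proof -
  have "query_block d \<phi> Q b \<in> carrier_vec d" for \<phi> b
    unfolding query_block_def using assms by (intro finsum_vec_closed) auto
  then have "dim_vec (fde_query k D R d \<omega> Q) = length [0..<R] * (length (clusters k) * D)"
    unfolding fde_query_def by (intro dim_concat_vec) (simp add: case_prod_beta dim_concat_vec dim_inner_proj)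
  then show ?thesis
    by (intro carrier_vecI) (simp add: fde_dim_def length_clusters)
qed

lemma fde_doc_carrier:
  assumes "P \<subseteq> carrier_vec d"
    and "\<And>i b. i < R \<Longrightarrow> b \<in> set (clusters k) \<Longrightarrow> fill i (fst (\<omega> i)) b \<in> P"
  shows "fde_doc k D R d fill \<omega> P \<in> carrier_vec (fde_dim k D R)"
proof -
  have "doc_block d \<phi> (fill i (fst (\<omega> i))) P b \<in> carrier_vec d"
    if "i < R" "b \<in> set (clusters k)" for \<phi> i b
    unfolding doc_block_def Let_def using assms that
    by (auto intro!: finsum_vec_closed smult_carrier_vec[THEN iffD2])
  then have "dim_vec (fde_doc k D R d fill \<omega> P) = length [0..<R] * (length (clusters k) * D)"
    unfolding fde_doc_def
    by (intro dim_concat_vec) (simp add: case_prod_beta dim_concat_vec dim_inner_proj)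
  then show ?thesis
    by (intro carrier_vecI) (simp add: fde_dim_def length_clusters)
qed

end

theory Submission
  imports Defs
begin

text \<open>
  By bilinearity the estimate is the average over \<open>q\<close> of
  \<open>\<Sum>p. w g q p * \<langle>\<psi> q, \<psi> p\<rangle>\<close>, where the weights \<open>w g q\<close> depend only on the partition \<open>g\<close>,
  are nonnegative, sum up to one and are concentrated on the document points whose code is
  nearest to that of \<open>q\<close>. Two codes differ in each bit independently with probability
  \<open>arccos \<langle>p, q\<rangle> / pi\<close>, so by Hoeffding's inequality the Hamming distances determine all angles up to
  \<open>O(\<epsilon>)\<close>, and the nearest points attain the maximal inner product up to \<open>\<epsilon> / 2\<close>. A Chernoff bound
  shows that \<open>\<psi>\<close> preserves all inner products up to \<open>\<epsilon> / 2\<close>. Since \<open>\<psi>\<close> preserves inner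
  products exactly in expectation, the expected estimate is that of the weights alone, which is
  never above the Chamfer similarity and falls far below it only if the partition is bad.
\<close>

section \<open>Rotation invariance of the planar Gaussian\<close>

text \<open>Two obstacles shape the proof. A SimHash bit pair depends on two Gaussian inner products
  in arbitrary dimension; their joint law is reduced to the plane one coordinate at a time, so that
  rotation invariance is only ever needed for two independent Gaussians. The product of two sign
  sums has no bound free of the dimension and is merely sub-exponential, so its exponential moments
  are bounded for small exponents only, through those of the squared sums. For the same reason the
  expectation is not read off the high-probability bound: where the projection fails, the estimate
  has no dimension-free bound. Averaging over the projection first leaves a quantity in the interval
  from -1 to 1, for which a bad partition costs at most twice its probability. Error budget: an
  error of \<open>\<epsilon> / 16\<close> per code bit is an angle error of
  \<open>2 * pi * \<epsilon> / 16\<close>, at most \<open>\<epsilon> / 2\<close> because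
  \<open>pi < 4\<close>; the projection gets the other half. Both failure probabilities are at most
  \<open>\<epsilon> * \<delta> / 4\<close>, which is below the \<open>\<epsilon> / 4\<close> that
  the expectation allows, and their sum is below \<delta>.\<close>

abbreviation std_gauss :: "real measure" where
  "std_gauss \<equiv> density lborel (\<lambda>x. ennreal (std_normal_density x))"

lemma prob_space_std_gauss: "prob_space std_gauss"
  by (rule prob_space_normal_density) simp

interpretation std_gauss: prob_space std_gauss
  by (rule prob_space_std_gauss)

lemma nn_integral_std_gauss:
  assumes [measurable]: "f \<in> borel_measurable borel"
  shows "(\<integral>\<^sup>+x. f x \<partial>std_gauss) = (\<integral>\<^sup>+x. ennreal (std_normal_density x) * f x \<partial>lborel)"
  by (subst nn_integral_density) auto

section \<open>Shears and rotations of planar Lebesgue measure\<close>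

lemma nn_integral_lborel_shift:
  assumes [measurable]: "f \<in> borel_measurable borel"
  shows "(\<integral>\<^sup>+x. f (x + t) \<partial>lborel) = (\<integral>\<^sup>+x. f (x::real) \<partial>lborel)"
  by (subst nn_integral_real_affine[of f 1 t]) (auto simp: add.commute)

lemma nn_integral_lborel_shear_snd:
  assumes [measurable]: "case_prod H \<in> borel_measurable (borel \<Otimes>\<^sub>M borel)"
  shows "(\<integral>\<^sup>+u. \<integral>\<^sup>+v. H u (v + t * u) \<partial>lborel \<partial>lborel) = (\<integral>\<^sup>+u. \<integral>\<^sup>+v. H u (v::real) \<partial>lborel \<partial>lborel)"
  by (intro nn_integral_cong nn_integral_lborel_shift) auto

lemma nn_integral_lborel_swap:
  assumes "case_prod H \<in> borel_measurable (borel \<Otimes>\<^sub>M borel)"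
  shows "(\<integral>\<^sup>+u. \<integral>\<^sup>+v. H u v \<partial>lborel \<partial>lborel) = (\<integral>\<^sup>+v. \<integral>\<^sup>+u. H (u::real) (v::real) \<partial>lborel \<partial>lborel)"
  using lborel_pair.Fubini'[of H] assms by (simp cong: measurable_cong_sets)

lemma nn_integral_lborel_shear_fst:
  assumes [measurable]: "case_prod H \<in> borel_measurable (borel \<Otimes>\<^sub>M borel)"
  shows "(\<integral>\<^sup>+u. \<integral>\<^sup>+v. H (u + t * v) v \<partial>lborel \<partial>lborel) = (\<integral>\<^sup>+u. \<integral>\<^sup>+v. H (u::real) (v::real) \<partial>lborel \<partial>lborel)"
proof -
  have "(\<integral>\<^sup>+u. \<integral>\<^sup>+v. H (u + t * v) v \<partial>lborel \<partial>lborel) = (\<integral>\<^sup>+v. \<integral>\<^sup>+u. H (u + t * v) v \<partial>lborel \<partial>lborel)"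
    by (rule nn_integral_lborel_swap) measurable
  also have "\<dots> = (\<integral>\<^sup>+v. \<integral>\<^sup>+u. H u v \<partial>lborel \<partial>lborel)"
    by (rule nn_integral_lborel_shear_snd[of "\<lambda>v u. H u v"]) measurable
  also have "\<dots> = (\<integral>\<^sup>+u. \<integral>\<^sup>+v. H u v \<partial>lborel \<partial>lborel)"
    by (rule nn_integral_lborel_swap[symmetric]) measurable
  finally show ?thesis .
qed

text \<open>A rotation that is not a multiple of the half turn is a product of three shears.\<close>

lemma nn_integral_lborel_rotation:
  assumes [measurable]: "case_prod H \<in> borel_measurable (borel \<Otimes>\<^sub>M borel)"
    and ab: "\<alpha>\<^sup>2 + \<beta>\<^sup>2 = (1::real)" "\<beta> \<noteq> 0"
  shows "(\<integral>\<^sup>+u. \<integral>\<^sup>+v. H (\<alpha> * u - \<beta> * v) (\<beta> * u + \<alpha> * v) \<partial>lborel \<partial>lborel) =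
    (\<integral>\<^sup>+u. \<integral>\<^sup>+v. H (u::real) (v::real) \<partial>lborel \<partial>lborel)"
proof -
  \<comment> \<open>For \<alpha> and \<beta> the cosine and sine of an angle t, this is
    \<open>- tan (t / 2)\<close>: the rotation is a vertical shear by \<beta> between two horizontal
    shears by s.\<close>
  define s where "s = (\<alpha> - 1) / \<beta>"
  have s: "s * \<beta> = \<alpha> - 1" "s * (1 + \<alpha>) = - \<beta>"
    using ab by (auto simp: s_def field_simps power2_eq_square)
  have "(\<integral>\<^sup>+u. \<integral>\<^sup>+v. H u v \<partial>lborel \<partial>lborel) = (\<integral>\<^sup>+u. \<integral>\<^sup>+v. H (u + s * v) v \<partial>lborel \<partial>lborel)"
    by (rule nn_integral_lborel_shear_fst[symmetric]) measurable
  also have "\<dots> = (\<integral>\<^sup>+u. \<integral>\<^sup>+v. H (u + s * (v + \<beta> * u)) (v + \<beta> * u) \<partial>lborel \<partial>lborel)"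
    by (rule nn_integral_lborel_shear_snd[symmetric, of "\<lambda>u v. H (u + s * v) v"]) measurable
  also have "\<dots> = (\<integral>\<^sup>+u. \<integral>\<^sup>+v. H ((u + s * v) + s * (v + \<beta> * (u + s * v))) (v + \<beta> * (u + s * v)) \<partial>lborel \<partial>lborel)"
    by (rule nn_integral_lborel_shear_fst[symmetric, of "\<lambda>u v. H (u + s * (v + \<beta> * u)) (v + \<beta> * u)"]) measurable
  also have "\<dots> = (\<integral>\<^sup>+u. \<integral>\<^sup>+v. H (\<alpha> * u - \<beta> * v) (\<beta> * u + \<alpha> * v) \<partial>lborel \<partial>lborel)"
  proof -
    have "v + \<beta> * (u + s * v) = \<beta> * u + \<alpha> * v" for u v
    proof -
      have "v + \<beta> * (u + s * v) = \<beta> * u + (1 + s * \<beta>) * v" by (simp add: algebra_simps)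
      then show ?thesis using s(1) by simp
    qed
    moreover have "(u + s * v) + s * (\<beta> * u + \<alpha> * v) = \<alpha> * u - \<beta> * v" for u v
    proof -
      have "(u + s * v) + s * (\<beta> * u + \<alpha> * v) = (1 + s * \<beta>) * u + (s * (1 + \<alpha>)) * v" by (simp add: algebra_simps)
      then show ?thesis using s by simp
    qed
    ultimately show ?thesis by simp
  qed
  finally show ?thesis ..
qed

section \<open>Rotations of a pair of independent standard Gaussians\<close>

lemma std_normal_density_rotation:
  assumes "\<alpha>\<^sup>2 + \<beta>\<^sup>2 = (1::real)"
  shows "std_normal_density (\<alpha> * u - \<beta> * v) * std_normal_density (\<beta> * u + \<alpha> * v) =
    std_normal_density u * std_normal_density v"
proof -
  have "(\<alpha> * u - \<beta> * v)\<^sup>2 + (\<beta> * u + \<alpha> * v)\<^sup>2 = (\<alpha>\<^sup>2 + \<beta>\<^sup>2) * (u\<^sup>2 + v\<^sup>2)"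
    by (simp add: algebra_simps power2_eq_square)
  then have "- (\<alpha> * u - \<beta> * v)\<^sup>2 / 2 + - (\<beta> * u + \<alpha> * v)\<^sup>2 / 2 = - u\<^sup>2 / 2 + - v\<^sup>2 / 2"
    using assms by (simp add: field_simps)
  then have "exp (- (\<alpha> * u - \<beta> * v)\<^sup>2 / 2) * exp (- (\<beta> * u + \<alpha> * v)\<^sup>2 / 2) = exp (- u\<^sup>2 / 2) * exp (- v\<^sup>2 / 2)"
    by (simp only: exp_add[symmetric])
  then show ?thesis
    unfolding std_normal_density_def by (simp add: field_simps)
qed

lemma nn_integral_std_gauss_pair:
  assumes [measurable]: "case_prod F \<in> borel_measurable (borel \<Otimes>\<^sub>M borel)"
  shows "(\<integral>\<^sup>+u. \<integral>\<^sup>+v. F u v \<partial>std_gauss \<partial>std_gauss) =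
    (\<integral>\<^sup>+u. \<integral>\<^sup>+v. ennreal (std_normal_density u * std_normal_density v) * F u v \<partial>lborel \<partial>lborel)"
proof -
  have "(\<integral>\<^sup>+u. \<integral>\<^sup>+v. F u v \<partial>std_gauss \<partial>std_gauss) =
     (\<integral>\<^sup>+u. ennreal (std_normal_density u) * (\<integral>\<^sup>+v. ennreal (std_normal_density v) * F u v \<partial>lborel) \<partial>lborel)"
    by (subst nn_integral_std_gauss[symmetric], measurable)
      (intro nn_integral_cong, subst nn_integral_std_gauss, auto)
  also have "\<dots> = (\<integral>\<^sup>+u. \<integral>\<^sup>+v. ennreal (std_normal_density u) * (ennreal (std_normal_density v) * F u v) \<partial>lborel \<partial>lborel)"
    by (intro nn_integral_cong nn_integral_cmult[symmetric]) measurable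
  finally show ?thesis
    by (simp add: ennreal_mult mult.assoc)
qed

lemma nn_integral_std_gauss_swap:
  assumes [measurable]: "case_prod F \<in> borel_measurable (borel \<Otimes>\<^sub>M borel)"
  shows "(\<integral>\<^sup>+u. \<integral>\<^sup>+v. F u v \<partial>std_gauss \<partial>std_gauss) = (\<integral>\<^sup>+v. \<integral>\<^sup>+u. F u v \<partial>std_gauss \<partial>std_gauss)"
  by (subst (1 2) nn_integral_std_gauss_pair, measurable)
    (subst nn_integral_lborel_swap, auto simp: mult.commute)

lemma nn_integral_std_gauss_rotation_aux:
  assumes [measurable]: "case_prod F \<in> borel_measurable (borel \<Otimes>\<^sub>M borel)"
    and ab: "\<alpha>\<^sup>2 + \<beta>\<^sup>2 = (1::real)" "\<beta> \<noteq> 0"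
  shows "(\<integral>\<^sup>+u. \<integral>\<^sup>+v. F (\<alpha> * u - \<beta> * v) (\<beta> * u + \<alpha> * v) \<partial>std_gauss \<partial>std_gauss) =
    (\<integral>\<^sup>+u. \<integral>\<^sup>+v. F u v \<partial>std_gauss \<partial>std_gauss)"
proof -
  have "(\<integral>\<^sup>+u. \<integral>\<^sup>+v. F (\<alpha> * u - \<beta> * v) (\<beta> * u + \<alpha> * v) \<partial>std_gauss \<partial>std_gauss) =
    (\<integral>\<^sup>+u. \<integral>\<^sup>+v. ennreal (std_normal_density u * std_normal_density v) *
        F (\<alpha> * u - \<beta> * v) (\<beta> * u + \<alpha> * v) \<partial>lborel \<partial>lborel)"
    by (rule nn_integral_std_gauss_pair) measurable
  also have "\<dots> = (\<integral>\<^sup>+u. \<integral>\<^sup>+v. (\<lambda>u v. ennreal (std_normal_density u * std_normal_density v) * F u v)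
        (\<alpha> * u - \<beta> * v) (\<beta> * u + \<alpha> * v) \<partial>lborel \<partial>lborel)"
    using std_normal_density_rotation[OF ab(1)] by simp
  also have "\<dots> = (\<integral>\<^sup>+u. \<integral>\<^sup>+v. ennreal (std_normal_density u * std_normal_density v) * F u v \<partial>lborel \<partial>lborel)"
    by (rule nn_integral_lborel_rotation[OF _ ab]) measurable
  also have "\<dots> = (\<integral>\<^sup>+u. \<integral>\<^sup>+v. F u v \<partial>std_gauss \<partial>std_gauss)"
    by (rule nn_integral_std_gauss_pair[symmetric]) measurable
  finally show ?thesis .
qed

lemma nn_integral_std_gauss_rotation:
  assumes [measurable]: "case_prod F \<in> borel_measurable (borel \<Otimes>\<^sub>M borel)"
    and ab: "\<alpha>\<^sup>2 + \<beta>\<^sup>2 = (1::real)"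
  shows "(\<integral>\<^sup>+u. \<integral>\<^sup>+v. F (\<alpha> * u - \<beta> * v) (\<beta> * u + \<alpha> * v) \<partial>std_gauss \<partial>std_gauss) =
    (\<integral>\<^sup>+u. \<integral>\<^sup>+v. F u v \<partial>std_gauss \<partial>std_gauss)"
proof (cases "\<beta> = 0")
  case False
  with ab show ?thesis by (intro nn_integral_std_gauss_rotation_aux) auto
next
  case True
  with ab consider "\<alpha> = 1" | "\<alpha> = -1" by (auto simp: power2_eq_1_iff)
  then show ?thesis
  proof cases
    case 2
    \<comment> \<open>the half turn is the square of the quarter turn\<close>
    have "(\<integral>\<^sup>+u. \<integral>\<^sup>+v. F (- u) (- v) \<partial>std_gauss \<partial>std_gauss) =
      (\<integral>\<^sup>+u. \<integral>\<^sup>+v. F (- v) u \<partial>std_gauss \<partial>std_gauss)"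
      using nn_integral_std_gauss_rotation_aux[of "\<lambda>u v. F (- v) u" 0 1] by simp
    also have "\<dots> = (\<integral>\<^sup>+u. \<integral>\<^sup>+v. F u v \<partial>std_gauss \<partial>std_gauss)"
      using nn_integral_std_gauss_rotation_aux[of F 0 1] by simp
    finally show ?thesis using True 2 by simp
  qed (use True in simp)
qed

text \<open>Stability of the Gaussian: a rotation that moves (a, b) onto the first axis leaves a
  function of one coordinate, and the other one integrates to 1.\<close>

lemma nn_integral_std_gauss_combine:
  assumes [measurable]: "f \<in> borel_measurable borel"
    and c: "c\<^sup>2 = a\<^sup>2 + (b::real)\<^sup>2"
  shows "(\<integral>\<^sup>+u. \<integral>\<^sup>+v. f (a * u + b * v) \<partial>std_gauss \<partial>std_gauss) = (\<integral>\<^sup>+u. f (c * u) \<partial>std_gauss)"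
proof (cases "c = 0")
  case True
  with c have "a = 0" "b = 0"
    by (auto simp: sum_power2_eq_zero_iff)
  with True show ?thesis by (simp add: std_gauss.emeasure_space_1[simplified])
next
  case False
  then have 1: "(a / c)\<^sup>2 + (- b / c)\<^sup>2 = 1"
    by (simp add: power_divide c[symmetric] add_divide_distrib[symmetric])
  have "(\<integral>\<^sup>+u. \<integral>\<^sup>+v. f (a * u + b * v) \<partial>std_gauss \<partial>std_gauss) = 
    (\<integral>\<^sup>+u. \<integral>\<^sup>+v. (\<lambda>u v. f (c * u)) (a / c * u - - b / c * v) (- b / c * u + a / c * v) \<partial>std_gauss \<partial>std_gauss)"
    using False by (simp add: algebra_simps)
  also have "\<dots> = (\<integral>\<^sup>+u. \<integral>\<^sup>+v. f (c * u) \<partial>std_gauss \<partial>std_gauss)"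
    by (rule nn_integral_std_gauss_rotation[OF _ 1]) measurable
  finally show ?thesis by (simp add: std_gauss.emeasure_space_1[simplified])
qed

text \<open>The triple \<open>(a, b, c)\<close> is a Cholesky factor of the Gram matrix of \<open>x\<close> and \<open>y\<close>.\<close>

lemma gaussian_pair_law:
  fixes x y :: "'i \<Rightarrow> real"
  assumes "finite I"
  shows "\<exists>a b c. 0 \<le> a \<and> 0 \<le> c \<and> a\<^sup>2 = (\<Sum>j\<in>I. (x j)\<^sup>2) \<and> a * b = (\<Sum>j\<in>I. x j * y j) \<and>
    b\<^sup>2 + c\<^sup>2 = (\<Sum>j\<in>I. (y j)\<^sup>2) \<and>
    (\<forall>F. case_prod F \<in> borel_measurable (borel \<Otimes>\<^sub>M borel) \<longrightarrow>
      (\<integral>\<^sup>+g. F (\<Sum>j\<in>I. g j * x j) (\<Sum>j\<in>I. g j * y j) \<partial>PiM I (\<lambda>_. std_gauss)) =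
      (\<integral>\<^sup>+u. \<integral>\<^sup>+w. F (a * u) (b * u + c * w) \<partial>std_gauss \<partial>std_gauss))"
  using assms
proof (induction I rule: finite_induct)
  case empty
  show ?case
    by (rule exI[of _ 0], rule exI[of _ 0], rule exI[of _ 0])
      (auto simp: PiM_empty nn_integral_count_space_finite std_gauss.emeasure_space_1[simplified])
next
  case (insert i I)
  interpret product_sigma_finite "\<lambda>_::'i. std_gauss" ..
  from insert.IH obtain a b c where ac: "0 \<le> a" "0 \<le> c"
    and gram: "a\<^sup>2 = (\<Sum>j\<in>I. (x j)\<^sup>2)" "a * b = (\<Sum>j\<in>I. x j * y j)" "b\<^sup>2 + c\<^sup>2 = (\<Sum>j\<in>I. (y j)\<^sup>2)"
    and law: "\<And>F. case_prod F \<in> borel_measurable (borel \<Otimes>\<^sub>M borel) \<Longrightarrow>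
      (\<integral>\<^sup>+g. F (\<Sum>j\<in>I. g j * x j) (\<Sum>j\<in>I. g j * y j) \<partial>PiM I (\<lambda>_. std_gauss)) =
      (\<integral>\<^sup>+u. \<integral>\<^sup>+w. F (a * u) (b * u + c * w) \<partial>std_gauss \<partial>std_gauss)"
    by blast
  have step: "(\<integral>\<^sup>+g. F (\<Sum>j\<in>insert i I. g j * x j) (\<Sum>j\<in>insert i I. g j * y j) \<partial>PiM (insert i I) (\<lambda>_. std_gauss)) =
     (\<integral>\<^sup>+v. \<integral>\<^sup>+u. \<integral>\<^sup>+w. F (a * u + x i * v) (b * u + y i * v + c * w) \<partial>std_gauss \<partial>std_gauss \<partial>std_gauss)"
    if [measurable]: "case_prod F \<in> borel_measurable (borel \<Otimes>\<^sub>M borel)" for F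
  proof -
    have "(\<integral>\<^sup>+g. F (\<Sum>j\<in>insert i I. g j * x j) (\<Sum>j\<in>insert i I. g j * y j) \<partial>PiM (insert i I) (\<lambda>_. std_gauss)) =
      (\<integral>\<^sup>+v. \<integral>\<^sup>+g. F (\<Sum>j\<in>insert i I. (g(i := v)) j * x j) (\<Sum>j\<in>insert i I. (g(i := v)) j * y j)
         \<partial>PiM I (\<lambda>_. std_gauss) \<partial>std_gauss)"
      using insert.hyps by (intro product_nn_integral_insert_rev) measurable
    also have "\<dots> = (\<integral>\<^sup>+v. \<integral>\<^sup>+g. (\<lambda>s t. F (s + x i * v) (t + y i * v)) (\<Sum>j\<in>I. g j * x j) (\<Sum>j\<in>I. g j * y j)
         \<partial>PiM I (\<lambda>_. std_gauss) \<partial>std_gauss)"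
    proof -
      have "(\<Sum>j\<in>insert i I. (g(i := v)) j * z j) = (\<Sum>j\<in>I. g j * z j) + z i * v" for g z :: "'i \<Rightarrow> real" and v
      proof -
        have "(\<Sum>j\<in>I. (g(i := v)) j * z j) = (\<Sum>j\<in>I. g j * z j)"
          using insert.hyps by (intro sum.cong) auto
        then show ?thesis using insert.hyps by (simp add: add.commute mult.commute)
      qed
      then show ?thesis by simp
    qed
    also have "\<dots> = (\<integral>\<^sup>+v. \<integral>\<^sup>+u. \<integral>\<^sup>+w. F (a * u + x i * v) (b * u + c * w + y i * v) \<partial>std_gauss \<partial>std_gauss \<partial>std_gauss)"
      by (intro nn_integral_cong law) measurable
    finally show ?thesis by (simp add: algebra_simps)
  qed
  define a' where "a' = sqrt (a\<^sup>2 + (x i)\<^sup>2)"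
  have a': "0 \<le> a'" "a'\<^sup>2 = a\<^sup>2 + (x i)\<^sup>2" by (auto simp: a'_def)
  have sums: "(\<Sum>j\<in>insert i I. (x j)\<^sup>2) = a\<^sup>2 + (x i)\<^sup>2" "(\<Sum>j\<in>insert i I. x j * y j) = a * b + x i * y i"
     "(\<Sum>j\<in>insert i I. (y j)\<^sup>2) = b\<^sup>2 + c\<^sup>2 + (y i)\<^sup>2"
    using insert.hyps gram by simp_all
  show ?case
  proof (cases "a' = 0")
    case True
    then have 0: "a = 0" "x i = 0" using a' by (auto simp: sum_power2_eq_zero_iff)
    \<comment> \<open>All coordinates of x vanish so far, so there is no direction to align with.
      The three independent terms with factors b, \<open>y i\<close> and c merge into one, in two
      steps, and the new b is 0.\<close>
    define e where "e = sqrt (b\<^sup>2 + (y i)\<^sup>2)"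
    define c' where "c' = sqrt (e\<^sup>2 + c\<^sup>2)"
    have e: "e\<^sup>2 = b\<^sup>2 + (y i)\<^sup>2" and c': "c'\<^sup>2 = e\<^sup>2 + c\<^sup>2" "0 \<le> c'" by (auto simp: e_def c'_def)
    have "(\<integral>\<^sup>+g. F (\<Sum>j\<in>insert i I. g j * x j) (\<Sum>j\<in>insert i I. g j * y j) \<partial>PiM (insert i I) (\<lambda>_. std_gauss)) =
      (\<integral>\<^sup>+u. \<integral>\<^sup>+w. F (0 * u) (0 * u + c' * w) \<partial>std_gauss \<partial>std_gauss)"
      if [measurable]: "case_prod F \<in> borel_measurable (borel \<Otimes>\<^sub>M borel)" for F
    proof -
      have "(\<integral>\<^sup>+g. F (\<Sum>j\<in>insert i I. g j * x j) (\<Sum>j\<in>insert i I. g j * y j) \<partial>PiM (insert i I) (\<lambda>_. std_gauss)) =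
        (\<integral>\<^sup>+v. \<integral>\<^sup>+u. (\<lambda>s. \<integral>\<^sup>+w. F 0 (s + c * w) \<partial>std_gauss) (y i * v + b * u) \<partial>std_gauss \<partial>std_gauss)"
        by (subst step) (auto simp: 0 add.commute)
      also have "\<dots> = (\<integral>\<^sup>+v. \<integral>\<^sup>+w. F 0 (e * v + c * w) \<partial>std_gauss \<partial>std_gauss)"
        by (rule nn_integral_std_gauss_combine) (measurable, simp add: e)
      also have "\<dots> = (\<integral>\<^sup>+w. F 0 (c' * w) \<partial>std_gauss)"
        by (rule nn_integral_std_gauss_combine) (measurable, simp add: c')
      finally show ?thesis by (simp add: std_gauss.emeasure_space_1[simplified])
    qed
    then show ?thesis
      unfolding sums using 0 e c' by (intro exI[of _ 0] exI[of _ c']) simp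
  next
    case False
    \<comment> \<open>A Givens rotation updates the Cholesky factor: in the (u, v) plane the unit
      vector along (a, \<open>x i\<close>) becomes the first axis, and b', y' are the coordinates of
      (b, \<open>y i\<close>) in the rotated frame. The part y' orthogonal to x is then merged with
      c into c'.\<close>
    define b' y' where "b' = (a * b + x i * y i) / a'" and "y' = (a * y i - b * x i) / a'"
    define c' where "c' = sqrt (y'\<^sup>2 + c\<^sup>2)"
    have c': "c'\<^sup>2 = y'\<^sup>2 + c\<^sup>2" "0 \<le> c'" by (auto simp: c'_def)
    have by': "b'\<^sup>2 + y'\<^sup>2 = b\<^sup>2 + (y i)\<^sup>2"
    proof -
      have "b'\<^sup>2 + y'\<^sup>2 = ((a * b + x i * y i)\<^sup>2 + (a * y i - b * x i)\<^sup>2) / a'\<^sup>2"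
        unfolding b'_def y'_def power_divide by (rule add_divide_distrib[symmetric])
      also have "(a * b + x i * y i)\<^sup>2 + (a * y i - b * x i)\<^sup>2 = (b\<^sup>2 + (y i)\<^sup>2) * a'\<^sup>2"
        unfolding a' by (simp add: algebra_simps power2_eq_square)
      finally show ?thesis using False by simp
    qed
    have 1: "(a / a')\<^sup>2 + (x i / a')\<^sup>2 = 1"
      using False by (simp add: power_divide a'(2)[symmetric] add_divide_distrib[symmetric])
    have "(\<integral>\<^sup>+g. F (\<Sum>j\<in>insert i I. g j * x j) (\<Sum>j\<in>insert i I. g j * y j) \<partial>PiM (insert i I) (\<lambda>_. std_gauss)) =
      (\<integral>\<^sup>+u. \<integral>\<^sup>+w. F (a' * u) (b' * u + c' * w) \<partial>std_gauss \<partial>std_gauss)"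
      if [measurable]: "case_prod F \<in> borel_measurable (borel \<Otimes>\<^sub>M borel)" for F
    proof -
      define G where "G = (\<lambda>u v. \<integral>\<^sup>+w. F (a * u + x i * v) (b * u + y i * v + c * w) \<partial>std_gauss)"
      have [measurable]: "case_prod G \<in> borel_measurable (borel \<Otimes>\<^sub>M borel)"
        unfolding G_def by measurable
      have "(\<integral>\<^sup>+g. F (\<Sum>j\<in>insert i I. g j * x j) (\<Sum>j\<in>insert i I. g j * y j) \<partial>PiM (insert i I) (\<lambda>_. std_gauss)) =
        (\<integral>\<^sup>+v. \<integral>\<^sup>+u. G u v \<partial>std_gauss \<partial>std_gauss)"
        by (subst step) (auto simp: G_def)
      also have "\<dots> = (\<integral>\<^sup>+u. \<integral>\<^sup>+v. G u v \<partial>std_gauss \<partial>std_gauss)"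
        by (rule nn_integral_std_gauss_swap) measurable
      also have "\<dots> = (\<integral>\<^sup>+u. \<integral>\<^sup>+v. G (a / a' * u - x i / a' * v) (x i / a' * u + a / a' * v) \<partial>std_gauss \<partial>std_gauss)"
        by (rule nn_integral_std_gauss_rotation[OF _ 1, symmetric]) measurable
      also have "\<dots> = (\<integral>\<^sup>+u. \<integral>\<^sup>+v. \<integral>\<^sup>+w. F (a' * u) (b' * u + (y' * v + c * w)) \<partial>std_gauss \<partial>std_gauss \<partial>std_gauss)"
      proof -
        have "a * (a / a' * u - x i / a' * v) + x i * (x i / a' * u + a / a' * v) = a' * u" for u v
        proof -
          have "a * (a / a' * u - x i / a' * v) + x i * (x i / a' * u + a / a' * v) = a'\<^sup>2 / a' * u"
            unfolding a'(2) by (simp add: algebra_simps add_divide_distrib power2_eq_square)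
          then show ?thesis using False by (simp add: power2_eq_square)
        qed
        moreover have "b * (a / a' * u - x i / a' * v) + y i * (x i / a' * u + a / a' * v) + c * w = b' * u + (y' * v + c * w)" for u v w
          using False by (simp add: b'_def y'_def field_simps)
        ultimately show ?thesis unfolding G_def by (simp only:)
      qed
      also have "\<dots> = (\<integral>\<^sup>+u. \<integral>\<^sup>+w. F (a' * u) (b' * u + c' * w) \<partial>std_gauss \<partial>std_gauss)"
        by (intro nn_integral_cong nn_integral_std_gauss_combine[of "\<lambda>s. F _ (_ + s)"]) (measurable, simp add: c')
      finally show ?thesis .
    qed
    then show ?thesis
      unfolding sums using a' c' by' False
      by (intro exI[of _ a'] exI[of _ b'] exI[of _ c']) (simp add: b'_def)
  qed
qed

section \<open>Sign disagreement of correlated Gaussians\<close>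

text \<open>This is the integral along a ray of slope v, used with \<open>s = 1 + v\<^sup>2\<close>;
  the factor u is the Jacobian of the substitution, and it is what makes the integrand
  elementary.\<close>

lemma nn_integral_gauss_radial:
  fixes s :: real assumes "0 < s"
  shows "(\<integral>\<^sup>+u. ennreal (u * exp (- (u\<^sup>2 * s) / 2)) * indicator {0..} u \<partial>lborel) = ennreal (1 / s)"
proof -
  have "(\<integral>\<^sup>+u. ennreal (u * exp (- (u\<^sup>2 * s) / 2)) * indicator {0..} u \<partial>lborel) =
      ennreal (0 - (- (exp (- (0\<^sup>2 * s) / 2) / s)))"
  proof (rule nn_integral_FTC_atLeast[where F = "\<lambda>u. - (exp (- (u\<^sup>2 * s) / 2) / s)"])
    show "((\<lambda>u. - (exp (- (u\<^sup>2 * s) / 2) / s)) has_field_derivative u * exp (- (u\<^sup>2 * s) / 2)) (at u)" for u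
      using assms by (auto intro!: derivative_eq_intros simp: field_simps)
    have "filterlim (\<lambda>u::real. u\<^sup>2 * (s / 2)) at_top at_top"
      using assms by (intro filterlim_tendsto_pos_mult_at_top_iff[THEN iffD2, OF tendsto_const] 
         filterlim_at_top_mult_tendsto_pos[OF tendsto_const] filterlim_pow_at_top filterlim_ident) auto
    then have "((\<lambda>u. exp (- (u\<^sup>2 * s / 2))) \<longlongrightarrow> 0) at_top"
      by (intro filterlim_compose[OF exp_at_bot]) (simp add: filterlim_uminus_at_bot)
    then have "((\<lambda>u. - (exp (- (u\<^sup>2 * s / 2)) / s)) \<longlongrightarrow> - (0 / s)) at_top"
      using assms by (intro tendsto_intros) auto
    then show "((\<lambda>u. - (exp (- (u\<^sup>2 * s) / 2) / s)) \<longlongrightarrow> 0) at_top" by simp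
  qed auto
  then show ?thesis by simp
qed

lemma nn_integral_cauchy_tail:
  "(\<integral>\<^sup>+v. ennreal (1 / (2 * pi * (1 + v\<^sup>2))) * indicator {..t} v \<partial>lborel) = ennreal ((arctan t + pi / 2) / (2 * pi))"
proof -
  have "(\<integral>\<^sup>+v. ennreal (1 / (2 * pi * (1 + v\<^sup>2))) * indicator {..t} v \<partial>lborel) =
    (\<integral>\<^sup>+v. ennreal (1 / (2 * pi * (1 + v\<^sup>2))) * indicator {-t..} v \<partial>lborel)"
    by (subst nn_integral_real_affine[where c = "-1" and t = 0])
      (auto intro!: nn_integral_cong simp: indicator_def)
  also have "\<dots> = ennreal (pi / 2 / (2 * pi) - arctan (-t) / (2 * pi))"
  proof (rule nn_integral_FTC_atLeast[where F = "\<lambda>v. arctan v / (2 * pi)"])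
    show "((\<lambda>v. arctan v / (2 * pi)) has_field_derivative 1 / (2 * pi * (1 + v\<^sup>2))) (at v)" for v
    proof -
      have "inverse (1 + v\<^sup>2) / (2 * pi) = 1 / (2 * pi * (1 + v\<^sup>2))"
        by (simp only: divide_inverse inverse_mult_distrib mult_1 mult_ac)
      then show ?thesis using DERIV_cdivide[OF DERIV_arctan, of "2 * pi" v] by (simp only:)
    qed
    show "((\<lambda>v. arctan v / (2 * pi)) \<longlongrightarrow> pi / 2 / (2 * pi)) at_top"
      by (intro tendsto_intros tendsto_arctan_at_top) auto
  qed auto
  also have "pi / 2 / (2 * pi) - arctan (-t) / (2 * pi) = (arctan t + pi / 2) / (2 * pi)"
    by (simp add: arctan_minus field_simps)
  finally show ?thesis .
qed

text \<open>The substitution \<open>w = u v\<close> turns the sector into a half line of slopes \<open>v\<close>,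
  which are Cauchy distributed.\<close>

lemma std_gauss_sector:
  "(\<integral>\<^sup>+u. \<integral>\<^sup>+w. indicator {0<..} u * indicator {..t * u} w \<partial>std_gauss \<partial>std_gauss) =
    ennreal ((arctan t + pi / 2) / (2 * pi))"
proof -
  let ?d = "\<lambda>u v. u * (std_normal_density u * std_normal_density (u * v))"
  have [measurable]: "(\<lambda>x. indicator {..t * fst x} (snd x) :: ennreal) \<in> borel_measurable (borel \<Otimes>\<^sub>M borel)"
  proof -
    have "(\<lambda>x. indicator {..t * fst x} (snd x) :: ennreal) = indicator {x \<in> space (borel \<Otimes>\<^sub>M borel). snd x \<le> t * fst x}"
      by (auto simp: indicator_def space_pair_measure)
    then show ?thesis by simp
  qed
  have "(\<integral>\<^sup>+u. \<integral>\<^sup>+w. indicator {0<..} u * indicator {..t * u} w \<partial>std_gauss \<partial>std_gauss) =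
    (\<integral>\<^sup>+u. \<integral>\<^sup>+w. ennreal (std_normal_density u * std_normal_density w) *
       (indicator {0<..} u * indicator {..t * u} w) \<partial>lborel \<partial>lborel)"
    by (rule nn_integral_std_gauss_pair) (simp add: case_prod_beta)
  also have "\<dots> = (\<integral>\<^sup>+u. \<integral>\<^sup>+v. ennreal (?d u v) * indicator {0..} u * indicator {..t} v \<partial>lborel \<partial>lborel)"
  proof (rule nn_integral_cong)
    fix u :: real
    show "(\<integral>\<^sup>+w. ennreal (std_normal_density u * std_normal_density w) *
       (indicator {0<..} u * indicator {..t * u} w) \<partial>lborel) =
       (\<integral>\<^sup>+v. ennreal (?d u v) * indicator {0..} u * indicator {..t} v \<partial>lborel)"
    proof (cases "u > 0")
      case True
      have "(\<integral>\<^sup>+w. ennreal (std_normal_density u * std_normal_density w) *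
         (indicator {0<..} u * indicator {..t * u} w) \<partial>lborel) =
         ennreal u * (\<integral>\<^sup>+v. ennreal (std_normal_density u * std_normal_density (u * v)) *
         (indicator {0<..} u * indicator {..t * u} (u * v)) \<partial>lborel)"
        using True by (subst nn_integral_real_affine[where c = u and t = 0]) auto
      also have "\<dots> = (\<integral>\<^sup>+v. ennreal u * (ennreal (std_normal_density u * std_normal_density (u * v)) *
         (indicator {0<..} u * indicator {..t * u} (u * v))) \<partial>lborel)"
        by (rule nn_integral_cmult[symmetric]) measurable
      also have "\<dots> = (\<integral>\<^sup>+v. ennreal (?d u v) * indicator {0..} u * indicator {..t} v \<partial>lborel)"
        using True by (intro nn_integral_cong) (auto simp: indicator_def ennreal_mult mult.commute[of t])
      finally show ?thesis .
    next
      case False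
      then show ?thesis by (cases "u = 0") auto
    qed
  qed
  also have "\<dots> = (\<integral>\<^sup>+v. \<integral>\<^sup>+u. ennreal (?d u v) * indicator {0..} u * indicator {..t} v \<partial>lborel \<partial>lborel)"
    by (rule nn_integral_lborel_swap) measurable
  also have "\<dots> = (\<integral>\<^sup>+v. ennreal (1 / (2 * pi * (1 + v\<^sup>2))) * indicator {..t} v \<partial>lborel)"
  proof (rule nn_integral_cong)
    fix v :: real
    have d: "?d u v = 1 / (2 * pi) * (u * exp (- (u\<^sup>2 * (1 + v\<^sup>2)) / 2))" for u
    proof -
      have "exp (- (u\<^sup>2 / 2)) * exp (- ((u * v)\<^sup>2 / 2)) = exp (- (u\<^sup>2 * (1 + v\<^sup>2)) / 2)"
        by (subst exp_add[symmetric]) (simp add: algebra_simps power2_eq_square add_divide_distrib)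
      then show ?thesis by (simp add: std_normal_density_def field_simps)
    qed
    have "0 < 1 + v\<^sup>2" by (simp add: add_pos_nonneg)
    have "(\<integral>\<^sup>+u. ennreal (?d u v) * indicator {0..} u * indicator {..t} v \<partial>lborel) =
      (\<integral>\<^sup>+u. (ennreal (1 / (2 * pi)) * indicator {..t} v) * (ennreal (u * exp (- (u\<^sup>2 * (1 + v\<^sup>2)) / 2)) * indicator {0..} u) \<partial>lborel)"
      unfolding d by (intro nn_integral_cong) (auto simp: indicator_def ennreal_mult[symmetric])
    also have "\<dots> = ennreal (1 / (2 * pi)) * indicator {..t} v * ennreal (1 / (1 + v\<^sup>2))"
      using nn_integral_gauss_radial[OF \<open>0 < 1 + v\<^sup>2\<close>] by (subst nn_integral_cmult) auto
    also have "\<dots> = ennreal (1 / (2 * pi * (1 + v\<^sup>2))) * indicator {..t} v"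
      using \<open>0 < 1 + v\<^sup>2\<close> by (auto simp: indicator_def ennreal_mult[symmetric])
    finally show "(\<integral>\<^sup>+u. ennreal (?d u v) * indicator {0..} u * indicator {..t} v \<partial>lborel) =
       ennreal (1 / (2 * pi * (1 + v\<^sup>2))) * indicator {..t} v" .
  qed
  also have "\<dots> = ennreal ((arctan t + pi / 2) / (2 * pi))"
    by (rule nn_integral_cauchy_tail)
  finally show ?thesis .
qed

lemma AE_std_gauss_neq: "AE x in std_gauss. x \<noteq> t"
  using AE_lborel_singleton[of t] by (subst AE_density) auto

text \<open>The signs disagree on two opposite sectors between the lines \<open>u = 0\<close> and
  \<open>b * u + c * w = 0\<close>. The half turn exchanges them, so each carries half of the
  probability. For c = 0 the second variable is u or -u and the sectors degenerate.\<close>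

lemma std_gauss_sign_disagreement:
  fixes b c :: real
  assumes bc: "b\<^sup>2 + c\<^sup>2 = 1" "0 \<le> c"
  shows "(\<integral>\<^sup>+u. \<integral>\<^sup>+w. of_bool ((0 < u) \<noteq> (0 < b * u + c * w)) \<partial>std_gauss \<partial>std_gauss) = ennreal (arccos b / pi)"
proof (cases "c = 0")
  case True
  with bc consider "b = 1" | "b = -1" by (auto simp: power2_eq_1_iff)
  then show ?thesis
  proof cases
    case 2
    have "(\<integral>\<^sup>+u. of_bool ((0 < u) \<noteq> (u < (0::real))) \<partial>std_gauss) = (\<integral>\<^sup>+u. 1 \<partial>std_gauss)"
      by (intro nn_integral_cong_AE eventually_mono[OF AE_std_gauss_neq[of 0]]) auto
    then show ?thesis using 2 True by (simp add: std_gauss.emeasure_space_1[simplified])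
  qed (use True in simp)
next
  case False
  define A where "A = (\<lambda>u w. (of_bool (0 < u \<and> w \<le> (- b / c) * u) :: ennreal))"
  define B where "B = (\<lambda>u w. (of_bool (u \<le> 0 \<and> - b / c * u < w) :: ennreal))"
  have [measurable]: "case_prod A \<in> borel_measurable (borel \<Otimes>\<^sub>M borel)"
    "case_prod B \<in> borel_measurable (borel \<Otimes>\<^sub>M borel)"
    unfolding A_def B_def by measurable
  have A: "(\<integral>\<^sup>+u. \<integral>\<^sup>+w. A u w \<partial>std_gauss \<partial>std_gauss) = ennreal ((arctan (- b / c) + pi / 2) / (2 * pi))"
    by (subst std_gauss_sector[symmetric], intro nn_integral_cong) (auto simp: A_def indicator_def)
  have "(\<integral>\<^sup>+u. \<integral>\<^sup>+w. B u w \<partial>std_gauss \<partial>std_gauss) = (\<integral>\<^sup>+u. \<integral>\<^sup>+w. B (- u) (- w) \<partial>std_gauss \<partial>std_gauss)"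
    using nn_integral_std_gauss_rotation[of B "-1" 0] by simp
  also have "\<dots> = (\<integral>\<^sup>+u. \<integral>\<^sup>+w. A u w \<partial>std_gauss \<partial>std_gauss)"
  \<comment> \<open>The half turn maps one sector onto the other only up to their boundary lines,
    which are treated differently by the strict and weak inequalities but are null sets.\<close>
  proof (rule nn_integral_cong_AE, rule eventually_mono[OF AE_std_gauss_neq[of 0]])
    fix u :: real assume "u \<noteq> 0"
    then show "(\<integral>\<^sup>+w. B (- u) (- w) \<partial>std_gauss) = (\<integral>\<^sup>+w. A u w \<partial>std_gauss)"
      by (intro nn_integral_cong_AE eventually_mono[OF AE_std_gauss_neq[of "- b / c * u"]])
        (auto simp: A_def B_def)
  qed
  finally have B: "(\<integral>\<^sup>+u. \<integral>\<^sup>+w. B u w \<partial>std_gauss \<partial>std_gauss) = (\<integral>\<^sup>+u. \<integral>\<^sup>+w. A u w \<partial>std_gauss \<partial>std_gauss)" .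
  have "of_bool ((0 < u) \<noteq> (0 < b * u + c * w)) = A u w + B u w" for u w
  proof -
    have "(0 < b * u + c * w) = (- b / c * u < w)"
      using False bc(2) by (simp add: field_simps) linarith
    then show ?thesis unfolding A_def B_def by (cases "0 < u") auto
  qed
  then have "(\<integral>\<^sup>+u. \<integral>\<^sup>+w. of_bool ((0 < u) \<noteq> (0 < b * u + c * w)) \<partial>std_gauss \<partial>std_gauss) =
     (\<integral>\<^sup>+u. (\<integral>\<^sup>+w. A u w \<partial>std_gauss) + (\<integral>\<^sup>+w. B u w \<partial>std_gauss) \<partial>std_gauss)"
    by (simp add: nn_integral_add)
  also have "\<dots> = (\<integral>\<^sup>+u. \<integral>\<^sup>+w. A u w \<partial>std_gauss \<partial>std_gauss) + (\<integral>\<^sup>+u. \<integral>\<^sup>+w. B u w \<partial>std_gauss \<partial>std_gauss)"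
    by (rule nn_integral_add) measurable
  also have "\<dots> = ennreal ((pi / 2 - arctan (b / c)) / pi)"
  proof -
    define r where "r = arctan (- b / c) + pi / 2"
    have "0 \<le> r" using arctan_lbound[of "- b / c"] by (simp add: r_def)
    then have "ennreal (r / (2 * pi)) + ennreal (r / (2 * pi)) = ennreal (r / (2 * pi) + r / (2 * pi))"
      by (intro ennreal_plus[symmetric]) auto
    also have "r / (2 * pi) + r / (2 * pi) = r / pi" by simp
    finally have "ennreal (r / (2 * pi)) + ennreal (r / (2 * pi)) = ennreal (r / pi)" .
    moreover have "r = pi / 2 - arctan (b / c)" by (simp add: r_def arctan_minus)
    ultimately show ?thesis unfolding B A r_def by simp
  qed
  also have "pi / 2 - arctan (b / c) = arccos b"
  proof -
    have "0 < c\<^sup>2" using False by simp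
    with bc have "b\<^sup>2 < 1" by linarith
    then have "\<bar>b\<bar> < 1" by (simp add: abs_square_less_1)
    moreover have "sqrt (1 - b\<^sup>2) = c" using bc by (intro real_sqrt_unique) auto
    ultimately show ?thesis by (simp add: arccos_arctan abs_less_iff)
  qed
  finally show ?thesis .
qed

text \<open>For unit vectors the Cholesky factor has a = 1, and b is their inner product, so only
  the planar angle is left. This is the random hyperplane formula of Goemans and Williamson.\<close>

lemma gaussian_sign_disagreement:
  fixes x y :: "'i \<Rightarrow> real"
  assumes I: "finite I" and x: "(\<Sum>j\<in>I. (x j)\<^sup>2) = 1" and y: "(\<Sum>j\<in>I. (y j)\<^sup>2) = 1"
  shows "measure (PiM I (\<lambda>_. std_gauss))
      {g \<in> space (PiM I (\<lambda>_. std_gauss)). (0 < (\<Sum>j\<in>I. g j * x j)) \<noteq> (0 < (\<Sum>j\<in>I. g j * y j))} =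
    arccos (\<Sum>j\<in>I. x j * y j) / pi" (is "measure ?M ?E = _")
proof -
  obtain a b c where ac: "0 \<le> a" "0 \<le> c"
    and gram: "a\<^sup>2 = (\<Sum>j\<in>I. (x j)\<^sup>2)" "a * b = (\<Sum>j\<in>I. x j * y j)" "b\<^sup>2 + c\<^sup>2 = (\<Sum>j\<in>I. (y j)\<^sup>2)"
    and law: "\<And>F. case_prod F \<in> borel_measurable (borel \<Otimes>\<^sub>M borel) \<Longrightarrow>
      (\<integral>\<^sup>+g. F (\<Sum>j\<in>I. g j * x j) (\<Sum>j\<in>I. g j * y j) \<partial>?M) =
      (\<integral>\<^sup>+u. \<integral>\<^sup>+w. F (a * u) (b * u + c * w) \<partial>std_gauss \<partial>std_gauss)"
    using gaussian_pair_law[OF I, of x y] by blast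
  have a: "a = 1" using ac gram x by (simp add: power2_eq_1_iff)
  with gram y have bc: "b\<^sup>2 + c\<^sup>2 = 1" and b: "b = (\<Sum>j\<in>I. x j * y j)" by auto
  have "emeasure ?M ?E = (\<integral>\<^sup>+g. indicator ?E g \<partial>?M)"
    by (rule nn_integral_indicator[symmetric]) measurable
  also have "\<dots> = (\<integral>\<^sup>+g. (\<lambda>s t. of_bool ((0 < s) \<noteq> (0 < t))) (\<Sum>j\<in>I. g j * x j) (\<Sum>j\<in>I. g j * y j) \<partial>?M)"
    by (intro nn_integral_cong) (auto simp: indicator_def)
  also have "\<dots> = (\<integral>\<^sup>+u. \<integral>\<^sup>+w. of_bool ((0 < u) \<noteq> (0 < b * u + c * w)) \<partial>std_gauss \<partial>std_gauss)"
    by (subst law) (auto simp: a)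
  also have "\<dots> = ennreal (arccos b / pi)"
    using bc ac(2) by (rule std_gauss_sign_disagreement)
  finally have "emeasure ?M ?E = ennreal (arccos b / pi)" .
  moreover have "b\<^sup>2 \<le> 1" using bc by (smt (verit) zero_le_power2)
  then have "\<bar>b\<bar> \<le> 1" by (simp add: abs_square_le_1)
  then have "0 \<le> arccos b / pi" by (intro divide_nonneg_nonneg arccos_lbound) auto
  ultimately show ?thesis
    by (simp add: b measure_def)
qed

section \<open>Concentration of SimHash\<close>

lemma indep_vars_PiM_coordinates:
  assumes "I \<noteq> {}" and N: "prob_space N"
  shows "prob_space.indep_vars (PiM I (\<lambda>_. N)) (\<lambda>_. N) (\<lambda>i \<omega>. \<omega> i) I"
proof -
  interpret prob_space "PiM I (\<lambda>_. N)" by (intro prob_space_PiM N)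
  \<comment> \<open>Independence amounts to the joint law being the product of the marginals; here
    the joint map is the identity on the product space.\<close>
  have "distr (PiM I (\<lambda>_. N)) (PiM I (\<lambda>_. N)) (\<lambda>\<omega>. \<lambda>i\<in>I. \<omega> i) = distr (PiM I (\<lambda>_. N)) (PiM I (\<lambda>_. N)) (\<lambda>\<omega>. \<omega>)"
    by (intro distr_cong) (auto simp: space_PiM)
  also have "\<dots> = PiM I (\<lambda>i. distr (PiM I (\<lambda>_. N)) N (\<lambda>\<omega>. \<omega> i))"
    using N by (subst distr_id) (intro PiM_cong refl distr_PiM_component[symmetric])
  finally show ?thesis
    using assms(1) by (subst indep_vars_iff_distr_eq_PiM') auto
qed

text \<open>Rows are disjoint blocks of independent coordinates. The entry law N is left open
  because the same fact serves the Gaussian vectors and the sign matrix.\<close>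

lemma indep_vars_rows:
  fixes f :: "(nat \<Rightarrow> real) \<Rightarrow> real" and N :: "real measure"
  assumes "0 < k" "0 < d" and N: "prob_space N"
    and f: "f \<in> borel_measurable (PiM {..<d} (\<lambda>_. N))"
  shows "prob_space.indep_vars (PiM ({..<k} \<times> {..<d}) (\<lambda>_. N)) (\<lambda>_. borel)
    (\<lambda>i g. f (\<lambda>j\<in>{..<d}. g (i, j))) {..<k::nat}"
proof -
  let ?I = "{..<k} \<times> {..<d}"
  interpret prob_space "PiM ?I (\<lambda>_. N)" by (intro prob_space_PiM N)
  have ne: "?I \<noteq> {}" using assms by auto
  have "indep_vars (\<lambda>i. PiM ({i} \<times> {..<d}) (\<lambda>_. N)) (\<lambda>i g. restrict g ({i} \<times> {..<d})) {..<k}"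
    using indep_vars_restrict[OF indep_vars_PiM_coordinates[OF ne N], of "{..<k}" "\<lambda>i. {i} \<times> {..<d}"]
    by (auto simp: disjoint_family_on_def)
  then have "indep_vars (\<lambda>_. borel) (\<lambda>i g. f (\<lambda>j\<in>{..<d}. restrict g ({i} \<times> {..<d}) (i, j))) {..<k}"
  proof (rule indep_vars_compose2)
    fix i
    show "(\<lambda>h. f (\<lambda>j\<in>{..<d}. h (i, j))) \<in> borel_measurable (PiM ({i} \<times> {..<d}) (\<lambda>_. N))"
      by (rule measurable_compose[OF _ f]) (intro measurable_restrict measurable_component_singleton, auto)
  qed
  moreover have "(\<lambda>j\<in>{..<d}. restrict g ({i} \<times> {..<d}) (i, j)) = (\<lambda>j\<in>{..<d}. g (i, j))" for g :: "nat \<times> nat \<Rightarrow> real" and i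
    by (auto simp: fun_eq_iff)
  ultimately show ?thesis by simp
qed

lemma sum_row:
  fixes f :: "nat \<times> nat \<Rightarrow> 'a::comm_monoid_add"
  assumes "i < k"
  shows "(\<Sum>p\<in>{..<k} \<times> {..<d}. if fst p = i then f p else 0) = (\<Sum>j<d. f (i, j))"
proof -
  have "(\<Sum>p\<in>{..<k} \<times> {..<d}. if fst p = i then f p else 0) = (\<Sum>i'<k. \<Sum>j<d. if i' = i then f (i', j) else 0)"
    by (subst sum.cartesian_product) (auto intro!: sum.cong)
  also have "\<dots> = (\<Sum>i'<k. if i' = i then (\<Sum>j<d. f (i', j)) else 0)"
    by (intro sum.cong) auto
  finally show ?thesis using assms by simp
qed

text \<open>A single row enters as a zero-padded vector on the whole index set. Facts about sums
  over all coordinates then apply to one row without passing to a marginal measure.\<close>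

lemma sum_row_mult:
  fixes g :: "nat \<times> nat \<Rightarrow> real"
  assumes "i < k"
  shows "(\<Sum>p\<in>{..<k} \<times> {..<d}. g p * (if fst p = i then b (snd p) else 0)) = (\<Sum>j<d. g (i, j) * b j)"
proof -
  have "(\<Sum>p\<in>{..<k} \<times> {..<d}. g p * (if fst p = i then b (snd p) else 0)) =
      (\<Sum>p\<in>{..<k} \<times> {..<d}. if fst p = i then g p * b (snd p) else 0)"
    by (intro sum.cong) auto
  then show ?thesis unfolding sum_row[OF assms] by simp
qed

section \<open>Hamming distances between SimHash codes\<close>

lemma row_scalar_prod:
  "x \<in> carrier_vec d \<Longrightarrow> vec d (\<lambda>j. g (i, j)) \<bullet> x = (\<Sum>j<d. g (i, j) * x $ j)"
  by (auto simp: scalar_prod_def atLeast0LessThan intro!: sum.cong)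

lemma length_simhash [simp]: "length (simhash k d g x) = k"
  by (simp add: simhash_def)

lemma nth_simhash:
  "i < k \<Longrightarrow> x \<in> carrier_vec d \<Longrightarrow> simhash k d g x ! i \<longleftrightarrow> 0 < (\<Sum>j<d. g (i, j) * x $ j)"
  by (simp add: simhash_def row_scalar_prod)

lemma real_hamming_simhash:
  assumes "x \<in> carrier_vec d" "y \<in> carrier_vec d"
  shows "real (hamming (simhash k d g x) (simhash k d g y)) =
    (\<Sum>i<k. of_bool ((0 < (\<Sum>j<d. g (i, j) * x $ j)) \<noteq> (0 < (\<Sum>j<d. g (i, j) * y $ j))))"
proof -
  have "{i. i < length (simhash k d g x) \<and> simhash k d g x ! i \<noteq> simhash k d g y ! i} =
    {..<k} \<inter> {i. (0 < (\<Sum>j<d. g (i, j) * x $ j)) \<noteq> (0 < (\<Sum>j<d. g (i, j) * y $ j))}"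
    using assms by (auto simp: nth_simhash)
  then show ?thesis by (simp add: hamming_def)
qed

lemma prob_space_gauss_space: "prob_space (gauss_space k d)"
  unfolding gauss_space_def by (intro prob_space_PiM prob_space_std_gauss)

text \<open>The distance is a sum of k independent indicators, one for each Gaussian vector, whose
  common mean is the normalized angle; Hoeffding's inequality applies to them.\<close>

lemma simhash_concentration:
  assumes x: "x \<in> carrier_vec d" "x \<bullet> x = 1" and y: "y \<in> carrier_vec d" "y \<bullet> y = 1"
    and k: "0 < k" and \<eta>: "0 \<le> \<eta>"
  shows "measure (gauss_space k d) {g \<in> space (gauss_space k d).
      real k * \<eta> \<le> \<bar>real (hamming (simhash k d g x) (simhash k d g y)) - real k * (arccos (x \<bullet> y) / pi)\<bar>}
    \<le> 2 * exp (- 2 * real k * \<eta>\<^sup>2)"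
proof -
  have sp: "u \<bullet> v = (\<Sum>j<d. u $ j * v $ j)" if "v \<in> carrier_vec d" for u v :: "real vec"
    using that by (simp add: scalar_prod_def atLeast0LessThan)
  \<comment> \<open>A unit vector has at least one coordinate; this keeps the index set of the
    product nonempty, as the independence of rows demands.\<close>
  have d: "0 < d"
    using x sp[of x x] by (cases d) auto
  define I where "I = {..<k} \<times> {..<d}"
  have M: "gauss_space k d = PiM I (\<lambda>_. std_gauss)" by (simp add: gauss_space_def I_def)
  interpret prob_space "gauss_space k d" by (rule prob_space_gauss_space)
  define f :: "(nat \<Rightarrow> real) \<Rightarrow> real" where
    "f = (\<lambda>h. of_bool ((0 < (\<Sum>j<d. h j * x $ j)) \<noteq> (0 < (\<Sum>j<d. h j * y $ j))))"
  have [measurable]: "f \<in> borel_measurable (PiM {..<d} (\<lambda>_. std_gauss))"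
    unfolding f_def by measurable
  define X where "X = (\<lambda>i (g :: nat \<times> nat \<Rightarrow> real). f (\<lambda>j\<in>{..<d}. g (i, j)))"
  have indep: "indep_vars (\<lambda>_. borel) X {..<k}"
    unfolding X_def M I_def by (rule indep_vars_rows) (use k d prob_space_std_gauss in auto)
  have EX: "expectation (X i) = arccos (x \<bullet> y) / pi" if i: "i < k" for i
  proof -
    define x' y' where "x' = (\<lambda>p. if fst p = i then x $ snd p else 0)" and "y' = (\<lambda>p. if fst p = i then y $ snd p else 0)"
    have row: "(\<Sum>p\<in>I. g p * x' p) = (\<Sum>j<d. g (i, j) * x $ j)"
      "(\<Sum>p\<in>I. g p * y' p) = (\<Sum>j<d. g (i, j) * y $ j)" for g
      unfolding I_def x'_def y'_def by (rule sum_row_mult[OF i])+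
    have X: "X i g = indicator {g \<in> space (gauss_space k d). (0 < (\<Sum>p\<in>I. g p * x' p)) \<noteq> (0 < (\<Sum>p\<in>I. g p * y' p))} g"
      if "g \<in> space (gauss_space k d)" for g
      using that unfolding X_def f_def row by (simp add: indicator_def of_bool_def)
    have "expectation (X i) = (\<integral>g. indicator {g \<in> space (gauss_space k d). (0 < (\<Sum>p\<in>I. g p * x' p)) \<noteq> (0 < (\<Sum>p\<in>I. g p * y' p))} g \<partial>gauss_space k d)"
      by (intro Bochner_Integration.integral_cong X refl)
    also have "\<dots> = prob {g \<in> space (gauss_space k d). (0 < (\<Sum>p\<in>I. g p * x' p)) \<noteq> (0 < (\<Sum>p\<in>I. g p * y' p))}"
      by (simp add: Int_absorb2)
    also have "\<dots> = arccos (\<Sum>p\<in>I. x' p * y' p) / pi"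
      unfolding M
    proof (rule gaussian_sign_disagreement)
      show "(\<Sum>p\<in>I. (x' p)\<^sup>2) = 1" "(\<Sum>p\<in>I. (y' p)\<^sup>2) = 1"
        \<comment> \<open>Here \<open>row\<close> is instantiated with the padded vectors themselves
          in place of g, which collapses their norms to those of x and y.\<close>
        unfolding power2_eq_square row using x y by (simp_all add: x'_def y'_def sp)
    qed (simp add: I_def)
    also have "(\<Sum>p\<in>I. x' p * y' p) = x \<bullet> y"
      unfolding row using y by (simp add: x'_def sp)
    finally show ?thesis .
  qed
  interpret Hoeffding_ineq "gauss_space k d" "{..<k}" X "\<lambda>_. 0" "\<lambda>_. 1" "\<Sum>i<k. expectation (X i)"
  proof unfold_locales
    show "indep_vars (\<lambda>_. borel) X {..<k}" by (rule indep)
    show "AE g in gauss_space k d. X i g \<in> {0..1}" for i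
      by (rule AE_I2) (simp add: X_def f_def)
  qed simp_all
  have "(\<Sum>i<k. X i g) = real (hamming (simhash k d g x) (simhash k d g y))" for g
    by (simp add: real_hamming_simhash[OF x(1) y(1)] X_def f_def)
  then have "prob {g \<in> space (gauss_space k d). real k * \<eta> \<le>
      \<bar>real (hamming (simhash k d g x) (simhash k d g y)) - real k * (arccos (x \<bullet> y) / pi)\<bar>}
    \<le> 2 * exp (-2 * (real k * \<eta>)\<^sup>2 / real k)"
    using Hoeffding_ineq_abs_ge[of "real k * \<eta>"] k \<eta> by (simp add: EX)
  also have "-2 * (real k * \<eta>)\<^sup>2 / real k = - 2 * real k * \<eta>\<^sup>2"
    using k by (simp add: power2_eq_square)
  finally show ?thesis .
qed

section \<open>Random sign matrices\<close>

abbreviation rademacher :: "real measure" where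
  "rademacher \<equiv> measure_pmf (pmf_of_set {-1, 1})"

section \<open>Exponential moments of sign sums and of their squares\<close>

lemma measurable_rademacher_component:
  "p \<in> I \<Longrightarrow> (\<lambda>s. s p) \<in> borel_measurable (PiM I (\<lambda>_. rademacher))"
  by (rule measurable_compose[OF measurable_component_singleton]) auto

lemma measurable_rademacher_sum:
  "(\<lambda>s. \<Sum>p\<in>I. s p * x p) \<in> borel_measurable (PiM I (\<lambda>_. rademacher))"
  by (intro borel_measurable_sum borel_measurable_times measurable_rademacher_component borel_measurable_const)

text \<open>Hoeffding's lemma for a centred variable in an interval of length
  \<open>2 * \<bar>z\<bar>\<close>: the exponent is the squared length divided by 8.\<close>

lemma rademacher_mgf:
  "(\<integral>\<^sup>+s. ennreal (exp (s * z)) \<partial>rademacher) \<le> ennreal (exp (z\<^sup>2 / 2))"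
proof -
  interpret interval_bounded_random_variable rademacher "\<lambda>s. s * z" "- \<bar>z\<bar>" "\<bar>z\<bar>"
    by unfold_locales (auto simp: AE_measure_pmf_iff)
  have "measure_pmf.expectation (pmf_of_set {-1, 1}) (\<lambda>s. s * z) = 0"
    by (subst integral_pmf_of_set) auto
  with Hoeffdings_lemma_nn_integral_0[of 1] show ?thesis
    by (simp add: power_mult_distrib)
qed

lemma rademacher_sum_mgf:
  assumes "finite I"
  shows "(\<integral>\<^sup>+s. ennreal (exp (t * (\<Sum>p\<in>I. s p * x p))) \<partial>PiM I (\<lambda>_. rademacher)) \<le>
    ennreal (exp (t\<^sup>2 * (\<Sum>p\<in>I. (x p)\<^sup>2) / 2))"
proof -
  interpret product_sigma_finite "\<lambda>_. rademacher"
    by unfold_locales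
  have "(\<integral>\<^sup>+s. ennreal (exp (t * (\<Sum>p\<in>I. s p * x p))) \<partial>PiM I (\<lambda>_. rademacher)) =
    (\<integral>\<^sup>+s. (\<Prod>p\<in>I. ennreal (exp (s p * (t * x p)))) \<partial>PiM I (\<lambda>_. rademacher))"
    using assms by (intro nn_integral_cong) (simp add: prod_ennreal exp_sum[symmetric] sum_distrib_left mult_ac)
  also have "\<dots> = (\<Prod>p\<in>I. \<integral>\<^sup>+s. ennreal (exp (s * (t * x p))) \<partial>rademacher)"
    using assms by (intro product_nn_integral_prod) auto
  also have "\<dots> \<le> (\<Prod>p\<in>I. ennreal (exp ((t * x p)\<^sup>2 / 2)))"
    by (intro prod_mono_ennreal rademacher_mgf)
  also have "\<dots> = ennreal (exp (t\<^sup>2 * (\<Sum>p\<in>I. (x p)\<^sup>2) / 2))"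
    using assms by (simp add: prod_ennreal exp_sum[symmetric] sum_distrib_left power_mult_distrib sum_divide_distrib)
  finally show ?thesis .
qed

lemma std_gauss_mgf: "(\<integral>\<^sup>+u. ennreal (exp (t * u)) \<partial>std_gauss) = ennreal (exp (t\<^sup>2 / 2))"
proof -
  have "(\<integral>\<^sup>+u. ennreal (exp (t * u)) \<partial>std_gauss) = (\<integral>\<^sup>+u. ennreal (exp (t\<^sup>2 / 2)) * ennreal (normal_density t 1 u) \<partial>lborel)"
  proof (subst nn_integral_std_gauss, measurable, rule nn_integral_cong)
    fix u :: real
    have "exp (- (u\<^sup>2 / 2)) * exp (t * u) = exp (t\<^sup>2 / 2) * exp (- ((u - t)\<^sup>2 / 2))"
      unfolding exp_add[symmetric] by (simp add: power2_eq_square algebra_simps add_divide_distrib diff_divide_distrib)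
    then show "ennreal (std_normal_density u) * ennreal (exp (t * u)) =
        ennreal (exp (t\<^sup>2 / 2)) * ennreal (normal_density t 1 u)"
      by (simp add: normal_density_def ennreal_mult[symmetric])
  qed
  also have "\<dots> = ennreal (exp (t\<^sup>2 / 2)) * emeasure (density lborel (normal_density t 1)) UNIV"
    by (subst nn_integral_cmult) (auto simp: emeasure_density)
  also have "emeasure (density lborel (normal_density t 1)) UNIV = 1"
    using prob_space.emeasure_space_1[OF prob_space_normal_density[of 1 t]] by simp
  finally show ?thesis by simp
qed

text \<open>With 3/8 the exponent of the density drops from 1/2 to 1/8, which belongs to the normal
  density of standard deviation 2; hence the exact value 2.\<close>

lemma std_gauss_square_mgf: "(\<integral>\<^sup>+u. ennreal (exp (3 / 8 * u\<^sup>2)) \<partial>std_gauss) = 2"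
proof -
  have "(\<integral>\<^sup>+u. ennreal (exp (3 / 8 * u\<^sup>2)) \<partial>std_gauss) = (\<integral>\<^sup>+u. 2 * ennreal (normal_density 0 2 u) \<partial>lborel)"
  proof (subst nn_integral_std_gauss, measurable, rule nn_integral_cong)
    fix u :: real
    have "exp (- (u\<^sup>2 / 2)) * exp (3 / 8 * u\<^sup>2) = exp (- (u\<^sup>2 / 8))"
      unfolding exp_add[symmetric] by simp
    then have "std_normal_density u * exp (3 / 8 * u\<^sup>2) = 1 / sqrt (2 * pi) * exp (- (u\<^sup>2 / 8))"
      by (simp add: std_normal_density_def)
    moreover have "sqrt (2 * pi * 2\<^sup>2) = sqrt (2 * pi) * 2"
      by (simp only: real_sqrt_mult real_sqrt_abs abs_numeral)
    then have "2 * normal_density 0 2 u = 1 / sqrt (2 * pi) * exp (- (u\<^sup>2 / 8))"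
      unfolding normal_density_def by (simp only:) simp
    ultimately have "std_normal_density u * exp (3 / 8 * u\<^sup>2) = 2 * normal_density 0 2 u"
      by (simp only:)
    moreover have "ennreal (2 * normal_density 0 2 u) = 2 * ennreal (normal_density 0 2 u)"
      by (subst ennreal_mult) auto
    ultimately show "ennreal (std_normal_density u) * ennreal (exp (3 / 8 * u\<^sup>2)) = 2 * ennreal (normal_density 0 2 u)"
      by (simp add: ennreal_mult[symmetric])
  qed
  also have "\<dots> = 2 * emeasure (density lborel (normal_density 0 2)) UNIV"
    by (subst nn_integral_cmult) (auto simp: emeasure_density)
  also have "emeasure (density lborel (normal_density 0 2)) UNIV = 1"
    using prob_space.emeasure_space_1[OF prob_space_normal_density[of 2 0]] by simp
  finally show ?thesis by simp
qed

lemma prob_space_rademacher_PiM: "prob_space (PiM I (\<lambda>_. rademacher))"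
  by (intro prob_space_PiM measure_pmf.prob_space_axioms)

text \<open>The square in the exponent is linearized by an independent Gaussian \<open>u\<close>.\<close>

lemma square_mgf_linearization:
  assumes "prob_space M" and [measurable]: "X \<in> borel_measurable M"
  shows "(\<integral>\<^sup>+s. ennreal (exp (3 / 8 * (X s)\<^sup>2)) \<partial>M) =
    (\<integral>\<^sup>+u. \<integral>\<^sup>+s. ennreal (exp (sqrt (3 / 4) * X s * u)) \<partial>M \<partial>std_gauss)"
proof -
  interpret M: prob_space M by fact
  interpret pair_sigma_finite M std_gauss ..
  have "(\<lambda>(s, u). ennreal (exp (sqrt (3 / 4) * X s * u))) \<in> borel_measurable (M \<Otimes>\<^sub>M std_gauss)"
    by measurable
  note swap = Fubini'[OF this]
  show ?thesis
    unfolding swap by (subst std_gauss_mgf) (simp add: power_mult_distrib)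
qed

text \<open>After linearization only the exponential moment of the sum itself is needed, and this is
  dominated by that of a standard Gaussian. So the square behaves no worse than a Gaussian square,
  whatever the number of summands.\<close>

lemma rademacher_square_mgf:
  assumes I: "finite I" and x: "(\<Sum>p\<in>I. (x p)\<^sup>2) = 1"
  shows "(\<integral>\<^sup>+s. ennreal (exp (3 / 8 * (\<Sum>p\<in>I. s p * x p)\<^sup>2)) \<partial>PiM I (\<lambda>_. rademacher)) \<le> 2"
proof -
  define X where "X = (\<lambda>s. \<Sum>p\<in>I. s p * x p)"
  let ?M = "PiM I (\<lambda>_. rademacher)"
  interpret M: prob_space ?M by (rule prob_space_rademacher_PiM)
  have "X \<in> borel_measurable ?M"
    unfolding X_def by (rule measurable_rademacher_sum)
  with M.prob_space_axioms
  have "(\<integral>\<^sup>+s. ennreal (exp (3 / 8 * (X s)\<^sup>2)) \<partial>?M) =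
      (\<integral>\<^sup>+u. \<integral>\<^sup>+s. ennreal (exp (sqrt (3 / 4) * X s * u)) \<partial>?M \<partial>std_gauss)"
    by (rule square_mgf_linearization)
  also have "\<dots> \<le> (\<integral>\<^sup>+u. ennreal (exp (3 / 8 * u\<^sup>2)) \<partial>std_gauss)"
  proof (rule nn_integral_mono)
    fix u
    show "(\<integral>\<^sup>+s. ennreal (exp (sqrt (3 / 4) * X s * u)) \<partial>?M) \<le> ennreal (exp (3 / 8 * u\<^sup>2))"
      using rademacher_sum_mgf[OF I, of "sqrt (3 / 4) * u" x]
      by (simp add: X_def x power_mult_distrib mult_ac)
  qed
  also have "\<dots> = 2" by (rule std_gauss_square_mgf)
  finally show ?thesis unfolding X_def .
qed

section \<open>Second moments of the sign entries\<close>

lemma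
  assumes I: "finite I" and pq: "p \<in> I" "q \<in> I"
  shows integrable_rademacher_mult: "integrable (PiM I (\<lambda>_. rademacher)) (\<lambda>s. s p * s q)"
    and integral_rademacher_mult: "(\<integral>s. s p * s q \<partial>PiM I (\<lambda>_. rademacher)) = of_bool (p = q)"
proof -
  let ?M = "PiM I (\<lambda>_. rademacher)"
  interpret M: prob_space ?M by (rule prob_space_rademacher_PiM)
  interpret P: product_sigma_finite "\<lambda>_. rademacher" by unfold_locales
  \<comment> \<open>The underlying space contains all real arrays; entries are signs only almost
    surely.\<close>
  have AE: "AE s in ?M. s r = -1 \<or> s r = 1" if "r \<in> I" for r
    using that by (intro AE_PiM_component[of I "\<lambda>_. rademacher" r "\<lambda>z. z = -1 \<or> z = 1"])
      (auto simp: AE_measure_pmf_iff measure_pmf.prob_space_axioms)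
  have "AE s in ?M. norm (s p * s q) \<le> 1"
    using AE[OF pq(1)] AE[OF pq(2)] by eventually_elim auto
  then show "integrable ?M (\<lambda>s. s p * s q)"
    using pq by (intro M.integrable_const_bound[where B = 1] borel_measurable_times measurable_rademacher_component)
  show "(\<integral>s. s p * s q \<partial>?M) = of_bool (p = q)"
  proof (cases "p = q")
    case True
    have "(\<integral>s. s p * s q \<partial>?M) = (\<integral>s. 1 \<partial>?M)"
    proof (rule integral_cong_AE)
      show "AE s in ?M. s p * s q = 1"
        using AE[OF pq(1)] by eventually_elim (auto simp: True)
    qed (use pq in \<open>auto intro!: borel_measurable_times measurable_rademacher_component\<close>)
    then show ?thesis using True by (simp add: M.prob_space)
  next
    case False
    \<comment> \<open>Padding with the factor 1 outside p and q turns the integrand into a product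
      over all coordinates; the factor at p then integrates to 0.\<close>
    define f where "f = (\<lambda>i (z :: real). if i = p \<or> i = q then z else 1)"
    have int: "integrable rademacher (f i)" for i
      by (rule integrable_measure_pmf_finite) simp
    have "(\<Prod>i\<in>I. f i (s i)) = s p * s q" for s
    proof -
      have "(\<Prod>i\<in>I. f i (s i)) = (\<Prod>i\<in>{p, q}. f i (s i))"
        using I pq by (intro prod.mono_neutral_right) (auto simp: f_def)
      then show ?thesis using False by (simp add: f_def)
    qed
    then have "(\<integral>s. s p * s q \<partial>?M) = (\<Prod>i\<in>I. \<integral>z. f i z \<partial>rademacher)"
      using P.product_integral_prod[of I f, OF I int] by simp
    also have "(\<integral>z. f p z \<partial>rademacher) = 0"
      by (subst integral_pmf_of_set) (auto simp: f_def)
    then have "(\<Prod>i\<in>I. \<integral>z. f i z \<partial>rademacher) = 0"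
      using I pq by (intro prod_zero) auto
    finally show ?thesis using False by simp
  qed
qed

lemma
  assumes I: "finite I"
  shows integrable_rademacher_bilinear:
      "integrable (PiM I (\<lambda>_. rademacher)) (\<lambda>s. (\<Sum>p\<in>I. s p * x p) * (\<Sum>p\<in>I. s p * y p))"
    and integral_rademacher_bilinear:
      "(\<integral>s. (\<Sum>p\<in>I. s p * x p) * (\<Sum>p\<in>I. s p * y p) \<partial>PiM I (\<lambda>_. rademacher)) = (\<Sum>p\<in>I. x p * y p)"
proof -
  have eq: "(\<Sum>p\<in>I. s p * x p) * (\<Sum>p\<in>I. s p * y p) = (\<Sum>p\<in>I. \<Sum>q\<in>I. x p * y q * (s p * s q))" for s
    by (simp add: sum_product mult_ac)
  show "integrable (PiM I (\<lambda>_. rademacher)) (\<lambda>s. (\<Sum>p\<in>I. s p * x p) * (\<Sum>p\<in>I. s p * y p))"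
    unfolding eq using I by (intro Bochner_Integration.integrable_sum integrable_mult_right integrable_rademacher_mult)
  have "(\<integral>s. (\<Sum>p\<in>I. \<Sum>q\<in>I. x p * y q * (s p * s q)) \<partial>PiM I (\<lambda>_. rademacher)) =
      (\<Sum>p\<in>I. \<Sum>q\<in>I. x p * y q * of_bool (p = q))"
    using I by (simp add: integral_rademacher_mult integrable_rademacher_mult)
  also have "\<dots> = (\<Sum>p\<in>I. x p * y p)"
    using I by (simp add: of_bool_def if_distrib[of "\<lambda>a. _ * a"] cong: if_cong)
  finally show "(\<integral>s. (\<Sum>p\<in>I. s p * x p) * (\<Sum>p\<in>I. s p * y p) \<partial>PiM I (\<lambda>_. rademacher)) = (\<Sum>p\<in>I. x p * y p)"
    unfolding eq .
qed

text \<open>The linear term is kept exactly because it vanishes in expectation for a centred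
  variable; only the remainder has to be estimated.\<close>

lemma exp_le_quadratic:
  fixes u :: real
  shows "exp u \<le> 1 + u + u\<^sup>2 * exp \<bar>u\<bar>"
proof -
  obtain t where t: "\<bar>t\<bar> \<le> \<bar>u\<bar>" "exp u = (\<Sum>m<2. u ^ m / fact m) + exp t / fact 2 * u ^ 2"
    using Maclaurin_exp_le[of u 2] by auto
  have "exp t / 2 * u\<^sup>2 \<le> exp \<bar>u\<bar> * u\<^sup>2"
  proof (rule mult_right_mono)
    have "exp t \<le> exp \<bar>u\<bar>" using t(1) by simp
    then show "exp t / 2 \<le> exp \<bar>u\<bar>" using exp_ge_zero[of t] by linarith
  qed simp
  then show ?thesis
    using t(2) by (simp add: numeral_2_eq_2 mult.commute)
qed

text \<open>A Bernstein type bound. The quadratic remainder for the centred product is at most 512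
  times the sum of the exponentials of 3/8 of the two squared sums, each of expectation at most 2;
  hence \<open>2048 = 512 * (2 + 2)\<close>. The restriction on l keeps the remainder within the
  range where these exponentials are integrable.\<close>

lemma rademacher_product_mgf:
  assumes I: "finite I" and x: "(\<Sum>p\<in>I. (x p)\<^sup>2) = 1" and y: "(\<Sum>p\<in>I. (y p)\<^sup>2) = 1"
    and l: "\<bar>l\<bar> \<le> 1 / 16"
  defines "\<mu> \<equiv> (\<Sum>p\<in>I. x p * y p)"
  shows "(\<integral>\<^sup>+s. ennreal (exp (l * ((\<Sum>p\<in>I. s p * x p) * (\<Sum>p\<in>I. s p * y p) - \<mu>))) \<partial>PiM I (\<lambda>_. rademacher))
    \<le> ennreal (exp (2048 * l\<^sup>2))"
proof -
  let ?M = "PiM I (\<lambda>_. rademacher)"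
  interpret M: prob_space ?M by (rule prob_space_rademacher_PiM)
  define X Y where "X = (\<lambda>s. \<Sum>p\<in>I. s p * x p)" and "Y = (\<lambda>s. \<Sum>p\<in>I. s p * y p)"
  define Z where "Z = (\<lambda>s. X s * Y s - \<mu>)"
  have [measurable]: "X \<in> borel_measurable ?M" "Y \<in> borel_measurable ?M" "Z \<in> borel_measurable ?M"
    unfolding X_def Y_def Z_def
    by (intro borel_measurable_diff borel_measurable_times borel_measurable_const measurable_rademacher_sum)+
  have Zint: "integrable ?M Z" and Z0: "(\<integral>s. Z s \<partial>?M) = 0"
    using integrable_rademacher_bilinear[OF I, of x y] integral_rademacher_bilinear[OF I, of x y]
    unfolding Z_def X_def Y_def \<mu>_def by (auto simp: M.prob_space)
  have sq: "integrable ?M (\<lambda>s. exp (3 / 8 * (\<Sum>p\<in>I. s p * z p)\<^sup>2))"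
    "(\<integral>s. exp (3 / 8 * (\<Sum>p\<in>I. s p * z p)\<^sup>2) \<partial>?M) \<le> 2" if z: "(\<Sum>p\<in>I. (z p)\<^sup>2) = 1" for z
  proof -
    note * = rademacher_square_mgf[OF I z]
    note measurable_rademacher_sum[measurable]
    show int: "integrable ?M (\<lambda>s. exp (3 / 8 * (\<Sum>p\<in>I. s p * z p)\<^sup>2))"
      using * by (intro integrableI_nonneg) (auto simp: less_top[symmetric] top_unique)
    have "ennreal (\<integral>s. exp (3 / 8 * (\<Sum>p\<in>I. s p * z p)\<^sup>2) \<partial>?M) \<le> ennreal 2"
      using * nn_integral_eq_integral[OF int] by simp
    then show "(\<integral>s. exp (3 / 8 * (\<Sum>p\<in>I. s p * z p)\<^sup>2) \<partial>?M) \<le> 2"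
      by (subst (asm) ennreal_le_iff) auto
  qed
  have "\<bar>\<mu>\<bar> \<le> 1"
  proof -
    have "\<bar>\<mu>\<bar> \<le> (\<Sum>p\<in>I. ((x p)\<^sup>2 + (y p)\<^sup>2) / 2)"
      unfolding \<mu>_def
    proof (rule order_trans[OF sum_abs], rule sum_mono)
      fix p
      show "\<bar>x p * y p\<bar> \<le> ((x p)\<^sup>2 + (y p)\<^sup>2) / 2"
        using sum_squares_bound[of "\<bar>x p\<bar>" "\<bar>y p\<bar>"] by (simp add: abs_mult)
    qed
    also have "\<dots> = 1"
      using x y by (simp add: sum_divide_distrib[symmetric] sum.distrib)
    finally show ?thesis .
  qed
  have bound: "exp (l * Z s) \<le> 1 + l * Z s + l\<^sup>2 * (512 * (exp (3 / 8 * (X s)\<^sup>2) + exp (3 / 8 * (Y s)\<^sup>2)))" for s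
  proof -
    define w where "w = \<bar>Z s\<bar>"
    have w: "0 \<le> w" by (simp add: w_def)
    have "\<bar>X s * Y s\<bar> \<le> ((X s)\<^sup>2 + (Y s)\<^sup>2) / 2"
      using sum_squares_bound[of "\<bar>X s\<bar>" "\<bar>Y s\<bar>"] by (simp add: abs_mult)
    then have wle: "w \<le> ((X s)\<^sup>2 + (Y s)\<^sup>2) / 2 + 1"
      using \<open>\<bar>\<mu>\<bar> \<le> 1\<close> unfolding w_def Z_def by linarith
    have "w\<^sup>2 \<le> 512 * exp (w / 16)"
    proof -
      \<comment> \<open>The quadratic Taylor term alone gives the constant:
        \<open>512 = 2 * 16\<^sup>2\<close>.\<close>
      have "1 + w / 16 + (w / 16)\<^sup>2 / 2 \<le> exp (w / 16)"
        using w by (intro exp_lower_Taylor_quadratic) auto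
      then have "(w / 16)\<^sup>2 / 2 \<le> exp (w / 16)" using w by simp
      then show ?thesis by (simp add: power_divide)
    qed
    moreover have "exp \<bar>l * Z s\<bar> \<le> exp (w / 16)"
      using mult_right_mono[OF l w] by (simp add: abs_mult w_def)
    ultimately have "w\<^sup>2 * exp \<bar>l * Z s\<bar> \<le> 512 * exp (w / 16) * exp (w / 16)"
      by (intro mult_mono) auto
    also have "\<dots> = 512 * exp (w / 8)" by (simp add: exp_add[symmetric] mult.assoc)
    also have "exp (w / 8) \<le> exp (3 / 8 * (X s)\<^sup>2) + exp (3 / 8 * (Y s)\<^sup>2)"
    proof -
      define m where "m = max ((X s)\<^sup>2) ((Y s)\<^sup>2)"
      have "(X s)\<^sup>2 \<le> m" "(Y s)\<^sup>2 \<le> m" by (simp_all add: m_def)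
      then have "((X s)\<^sup>2 + (Y s)\<^sup>2) / 2 \<le> m" by simp
      then have m: "w \<le> m + 1"
        by (intro order_trans[OF wle] add_right_mono)
      have le: "exp (3 / 8 * m) \<le> exp (3 / 8 * (X s)\<^sup>2) + exp (3 / 8 * (Y s)\<^sup>2)"
        by (auto simp: m_def max_def)
      show ?thesis
      \<comment> \<open>The additive 1 comes from the mean \<mu>. For m at least 1/2 it is absorbed,
        as \<open>m + 1 \<le> 3 * m\<close>. For smaller m the left side is below 2, while the two
        exponentials on the right are at least 1 each.\<close>
      proof (cases "1 \<le> 2 * m")
        case True
        then have "exp (w / 8) \<le> exp (3 / 8 * m)" using m by simp
        then show ?thesis by (rule order_trans[OF _ le])
      next
        case False
        then have "exp (w / 8) \<le> exp (1 / 2)" using m by simp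
        also have "\<dots> \<le> 2" using exp_bound_half[of "1 / 2 :: real"] by simp
        also have "2 = 1 + (1::real)" by simp
        also have "\<dots> \<le> exp (3 / 8 * (X s)\<^sup>2) + exp (3 / 8 * (Y s)\<^sup>2)"
          by (intro add_mono) simp_all
        finally show ?thesis .
      qed
    qed
    finally have "l\<^sup>2 * (w\<^sup>2 * exp \<bar>l * Z s\<bar>) \<le> l\<^sup>2 * (512 * (exp (3 / 8 * (X s)\<^sup>2) + exp (3 / 8 * (Y s)\<^sup>2)))"
      by (intro mult_left_mono) auto
    then show ?thesis
      using exp_le_quadratic[of "l * Z s"] by (simp add: w_def power_mult_distrib mult.assoc)
  qed
  define W where "W = (\<lambda>s. 1 + l * Z s + l\<^sup>2 * (512 * (exp (3 / 8 * (X s)\<^sup>2) + exp (3 / 8 * (Y s)\<^sup>2))))"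
  have intX: "integrable ?M (\<lambda>s. exp (3 / 8 * (X s)\<^sup>2))" "(\<integral>s. exp (3 / 8 * (X s)\<^sup>2) \<partial>?M) \<le> 2"
    and intY: "integrable ?M (\<lambda>s. exp (3 / 8 * (Y s)\<^sup>2))" "(\<integral>s. exp (3 / 8 * (Y s)\<^sup>2) \<partial>?M) \<le> 2"
    using sq[OF x] sq[OF y] unfolding X_def Y_def by auto
  have W: "integrable ?M W"
    unfolding W_def using intX intY Zint by (intro Bochner_Integration.integrable_add integrable_mult_right) auto
  have "(\<integral>\<^sup>+s. ennreal (exp (l * Z s)) \<partial>?M) \<le> (\<integral>\<^sup>+s. ennreal (W s) \<partial>?M)"
    using bound by (intro nn_integral_mono ennreal_leI) (simp add: W_def)
  also have "\<dots> = ennreal (\<integral>s. W s \<partial>?M)"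
    using bound by (intro nn_integral_eq_integral[OF W] AE_I2)
      (auto simp: W_def intro: order_trans[OF less_imp_le[OF exp_gt_zero]])
  finally have le: "(\<integral>\<^sup>+s. ennreal (exp (l * Z s)) \<partial>?M) \<le> ennreal (\<integral>s. W s \<partial>?M)" .
  have "(\<integral>s. W s \<partial>?M) = 1 + l\<^sup>2 * (512 * ((\<integral>s. exp (3 / 8 * (X s)\<^sup>2) \<partial>?M) + (\<integral>s. exp (3 / 8 * (Y s)\<^sup>2) \<partial>?M)))"
    unfolding W_def using intX intY Zint Z0
    by (simp add: M.prob_space del: distrib_left_numeral)
  also have "\<dots> \<le> 1 + l\<^sup>2 * (512 * (2 + 2))"
    using intX intY by (intro add_left_mono mult_left_mono add_mono) auto
  also have "\<dots> \<le> exp (2048 * l\<^sup>2)"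
    using exp_ge_add_one_self[of "2048 * l\<^sup>2"] by (simp add: mult.commute)
  finally have "(\<integral>s. W s \<partial>?M) \<le> exp (2048 * l\<^sup>2)" .
  from order_trans[OF le ennreal_leI[OF this]] show ?thesis
    unfolding Z_def X_def Y_def .
qed

section \<open>Concentration over the rows of the sign matrix\<close>

lemma prob_space_sign_space: "prob_space (sign_space D d)"
  unfolding sign_space_def by (rule prob_space_rademacher_PiM)

lemma measurable_sign_row:
  assumes "i < D"
  shows "(\<lambda>s. \<Sum>j<d. s (i, j) * x j) \<in> borel_measurable (sign_space D d)"
  unfolding sign_space_def using assms
  by (intro borel_measurable_sum borel_measurable_times measurable_rademacher_component borel_measurable_const) auto

lemma
  assumes i: "i < D"
  shows integrable_sign_row:
      "integrable (sign_space D d) (\<lambda>s. (\<Sum>j<d. s (i, j) * x j) * (\<Sum>j<d. s (i, j) * y j))"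
    and integral_sign_row:
      "(\<integral>s. (\<Sum>j<d. s (i, j) * x j) * (\<Sum>j<d. s (i, j) * y j) \<partial>sign_space D d) = (\<Sum>j<d. x j * y j)"
proof -
  let ?x = "\<lambda>p. if fst p = i then x (snd p) else 0" and ?y = "\<lambda>p. if fst p = i then y (snd p) else 0"
  have fin: "finite ({..<D} \<times> {..<d})" by simp
  show "integrable (sign_space D d) (\<lambda>s. (\<Sum>j<d. s (i, j) * x j) * (\<Sum>j<d. s (i, j) * y j))"
    using integrable_rademacher_bilinear[OF fin, of ?x ?y] unfolding sum_row_mult[OF i] sign_space_def .
  show "(\<integral>s. (\<Sum>j<d. s (i, j) * x j) * (\<Sum>j<d. s (i, j) * y j) \<partial>sign_space D d) = (\<Sum>j<d. x j * y j)"
    using integral_rademacher_bilinear[OF fin, of ?x ?y] sum_row_mult[OF i, where g = ?x and b = y]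
    unfolding sum_row_mult[OF i] sign_space_def by simp
qed

lemma sign_row_mgf:
  assumes x: "(\<Sum>j<d. (x j)\<^sup>2) = 1" and y: "(\<Sum>j<d. (y j)\<^sup>2) = 1"
    and i: "i < D" and l: "\<bar>l\<bar> \<le> 1 / 16"
  shows "(\<integral>\<^sup>+s. ennreal (exp (l * ((\<Sum>j<d. s (i, j) * x j) * (\<Sum>j<d. s (i, j) * y j) - (\<Sum>j<d. x j * y j)))) \<partial>sign_space D d)
    \<le> ennreal (exp (2048 * l\<^sup>2))"
proof -
  define x' y' where "x' = (\<lambda>p. if fst p = i then x (snd p) else 0)" and "y' = (\<lambda>p. if fst p = i then y (snd p) else 0)"
  have row: "(\<Sum>p\<in>{..<D} \<times> {..<d}. g p * x' p) = (\<Sum>j<d. g (i, j) * x j)"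
    "(\<Sum>p\<in>{..<D} \<times> {..<d}. g p * y' p) = (\<Sum>j<d. g (i, j) * y j)" for g
    unfolding x'_def y'_def by (rule sum_row_mult[OF i])+
  have "(\<Sum>p\<in>{..<D} \<times> {..<d}. (x' p)\<^sup>2) = 1" "(\<Sum>p\<in>{..<D} \<times> {..<d}. (y' p)\<^sup>2) = 1"
    unfolding power2_eq_square row using x y by (simp_all add: x'_def y'_def power2_eq_square)
  from rademacher_product_mgf[OF _ this l]
  have "(\<integral>\<^sup>+s. ennreal (exp (l * ((\<Sum>j<d. s (i, j) * x j) * (\<Sum>j<d. s (i, j) * y j) - (\<Sum>j<d. x' (i, j) * y j)))) \<partial>sign_space D d)
    \<le> ennreal (exp (2048 * l\<^sup>2))"
    unfolding row sign_space_def by simp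
  then show ?thesis by (simp add: x'_def)
qed

text \<open>The sign \<sigma> covers both tails at once, since the moment bound for a row depends
  only on the square of its exponent.\<close>

lemma sign_rows_upper_tail:
  assumes x: "(\<Sum>j<d. (x j)\<^sup>2) = 1" and y: "(\<Sum>j<d. (y j)\<^sup>2) = 1"
    and D: "0 < D" and \<eta>: "0 < \<eta>" "\<eta> \<le> 1" and \<sigma>: "\<sigma> \<in> {-1, 1::real}"
  shows "measure (sign_space D d) {s \<in> space (sign_space D d). real D * \<eta> \<le>
      \<sigma> * (\<Sum>i<D. (\<Sum>j<d. s (i, j) * x j) * (\<Sum>j<d. s (i, j) * y j) - (\<Sum>j<d. x j * y j))}
    \<le> exp (- real D * \<eta>\<^sup>2 / 8192)"
proof -
  let ?M = "sign_space D d"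
  interpret prob_space ?M by (rule prob_space_sign_space)
  define f where "f = (\<lambda>h. (\<Sum>j<d. h j * x j) * (\<Sum>j<d. h j * y j) - (\<Sum>j<d. x j * y j))"
  define Z where "Z = (\<lambda>i (s :: nat \<times> nat \<Rightarrow> real). f (\<lambda>j\<in>{..<d}. s (i, j)))"
  have Z: "Z i s = (\<Sum>j<d. s (i, j) * x j) * (\<Sum>j<d. s (i, j) * y j) - (\<Sum>j<d. x j * y j)" for i s
    by (simp add: Z_def f_def)
  have d: "0 < d" using x by (cases d) auto
  have f: "f \<in> borel_measurable (PiM {..<d} (\<lambda>_. rademacher))"
    unfolding f_def by (intro borel_measurable_diff borel_measurable_times borel_measurable_const measurable_rademacher_sum)
  have indep: "indep_vars (\<lambda>_. borel) Z {..<D}"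
    unfolding Z_def sign_space_def using D d f
    by (intro indep_vars_rows) (auto simp: measure_pmf.prob_space_axioms)
  have Zm: "Z i \<in> borel_measurable ?M" if "i < D" for i
    using that unfolding Z
    by (intro borel_measurable_diff borel_measurable_times borel_measurable_const measurable_sign_row)
  \<comment> \<open>This minimizes \<open>2048 * l\<^sup>2 - l * \<eta>\<close>, with minimum
    \<open>- \<eta>\<^sup>2 / 8192\<close>; as \<eta> is at most 1, it stays in the admissible range
    of exponents.\<close>
  define l where "l = \<eta> / 4096"
  have l: "0 < l" "\<bar>l * \<sigma>\<bar> \<le> 1 / 16" using \<eta> \<sigma> by (auto simp: l_def)
  have S: "(\<lambda>s. \<sigma> * (\<Sum>i<D. Z i s)) \<in> borel_measurable ?M"
    using Zm by (intro borel_measurable_times borel_measurable_sum borel_measurable_const) auto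
  have "emeasure ?M {s \<in> space ?M. real D * \<eta> \<le> \<sigma> * (\<Sum>i<D. Z i s)} \<le>
      ennreal (exp (- l * (real D * \<eta>))) *
      (\<integral>\<^sup>+s. ennreal (exp (l * (\<sigma> * (\<Sum>i<D. Z i s)))) * indicator (space ?M) s \<partial>?M)"
    using S l by (intro Chernoff_ineq_nn_integral_ge) auto
  also have "(\<integral>\<^sup>+s. ennreal (exp (l * (\<sigma> * (\<Sum>i<D. Z i s)))) * indicator (space ?M) s \<partial>?M) =
      (\<integral>\<^sup>+s. (\<Prod>i<D. ennreal (exp (l * \<sigma> * Z i s))) \<partial>?M)"
    by (intro nn_integral_cong) (simp add: prod_ennreal exp_sum[symmetric] sum_distrib_left mult.assoc)
  also have "\<dots> = (\<Prod>i<D. \<integral>\<^sup>+s. ennreal (exp (l * \<sigma> * Z i s)) \<partial>?M)"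
    by (intro indep_vars_nn_integral indep_vars_compose2[OF indep]) auto
  also have "\<dots> \<le> (\<Prod>i<D. ennreal (exp (2048 * (l * \<sigma>)\<^sup>2)))"
    unfolding Z using l(2) by (intro prod_mono_ennreal sign_row_mgf x y) auto
  also have "\<dots> = ennreal (exp (real D * (2048 * l\<^sup>2)))"
    using \<sigma> by (auto simp: prod_ennreal exp_of_nat_mult[symmetric] ennreal_power power_mult_distrib)
  finally have "emeasure ?M {s \<in> space ?M. real D * \<eta> \<le> \<sigma> * (\<Sum>i<D. Z i s)} \<le>
      ennreal (exp (- l * (real D * \<eta>)) * exp (real D * (2048 * l\<^sup>2)))"
    by (simp add: ennreal_mult mult_left_mono)
  also have "exp (- l * (real D * \<eta>)) * exp (real D * (2048 * l\<^sup>2)) = exp (- real D * \<eta>\<^sup>2 / 8192)"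
    unfolding exp_add[symmetric] by (simp add: l_def power2_eq_square)
  finally show ?thesis
    unfolding Z by (simp add: emeasure_eq_measure)
qed

lemma sign_rows_concentration:
  assumes x: "(\<Sum>j<d. (x j)\<^sup>2) = 1" and y: "(\<Sum>j<d. (y j)\<^sup>2) = 1"
    and D: "0 < D" and \<eta>: "0 < \<eta>" "\<eta> \<le> 1"
  shows "measure (sign_space D d) {s \<in> space (sign_space D d). real D * \<eta> \<le>
      \<bar>(\<Sum>i<D. (\<Sum>j<d. s (i, j) * x j) * (\<Sum>j<d. s (i, j) * y j)) - real D * (\<Sum>j<d. x j * y j)\<bar>}
    \<le> 2 * exp (- real D * \<eta>\<^sup>2 / 8192)"
proof -
  let ?M = "sign_space D d"
  interpret prob_space ?M by (rule prob_space_sign_space)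
  define S where "S = (\<lambda>s. \<Sum>i<D. (\<Sum>j<d. s (i, j) * x j) * (\<Sum>j<d. s (i, j) * y j) - (\<Sum>j<d. x j * y j))"
  have S: "(\<Sum>i<D. (\<Sum>j<d. s (i, j) * x j) * (\<Sum>j<d. s (i, j) * y j)) - real D * (\<Sum>j<d. x j * y j) = S s" for s
    by (simp add: S_def sum_subtractf)
  have [measurable]: "S \<in> borel_measurable ?M"
    unfolding S_def
    by (intro borel_measurable_sum borel_measurable_diff borel_measurable_times borel_measurable_const measurable_sign_row) auto
  have "prob {s \<in> space ?M. real D * \<eta> \<le> \<bar>S s\<bar>} \<le>
      prob ({s \<in> space ?M. real D * \<eta> \<le> 1 * S s} \<union> {s \<in> space ?M. real D * \<eta> \<le> -1 * S s})"
    by (intro finite_measure_mono) auto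
  also have "\<dots> \<le> prob {s \<in> space ?M. real D * \<eta> \<le> 1 * S s} + prob {s \<in> space ?M. real D * \<eta> \<le> -1 * S s}"
    by (intro measure_Un_le) auto
  also have "\<dots> \<le> exp (- real D * \<eta>\<^sup>2 / 8192) + exp (- real D * \<eta>\<^sup>2 / 8192)"
    unfolding S_def by (intro add_mono sign_rows_upper_tail assms) auto
  finally show ?thesis unfolding S by simp
qed

section \<open>Inner products of fixed dimensional encodings\<close>

lemma concat_vec_Cons: "concat_vec (v # vs) = v @\<^sub>v concat_vec vs"
  unfolding concat_vec_def
  by (intro eq_vecI) (auto simp: nth_append vec_of_list_index list_of_vec_index)

lemma scalar_prod_concat_vec:
  assumes "\<And>x. x \<in> set xs \<Longrightarrow> dim_vec (f x) = dim_vec (g x)"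
  shows "concat_vec (map f xs) \<bullet> concat_vec (map g xs) = (\<Sum>x\<leftarrow>xs. f x \<bullet> g x)"
  using assms
proof (induction xs)
  case Nil
  show ?case by (simp add: concat_vec_def scalar_prod_def)
next
  case (Cons x xs)
  have dims: "dim_vec (concat_vec (map f xs)) = dim_vec (concat_vec (map g xs))"
  proof -
    have "(\<Sum>x\<leftarrow>xs. dim_vec (f x)) = (\<Sum>x\<leftarrow>xs. dim_vec (g x))"
      using Cons.prems by (intro arg_cong[of _ _ sum_list] map_cong) auto
    then show ?thesis by (simp add: concat_vec_def length_concat comp_def)
  qed
  have "concat_vec (map f (x # xs)) \<bullet> concat_vec (map g (x # xs)) =
      f x \<bullet> g x + concat_vec (map f xs) \<bullet> concat_vec (map g xs)"
    unfolding list.map concat_vec_Cons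
    using Cons.prems[of x] dims by (intro scalar_prod_append carrier_vecI[OF refl] carrier_vecI) simp_all
  with Cons show ?case by simp
qed

lemma concat_vec_singleton: "concat_vec [v] = v"
  by (simp add: concat_vec_def vec_list)

lemma distinct_clusters: "distinct (clusters k)"
  by (simp add: clusters_def distinct_n_lists)

lemma simhash_in_clusters: "simhash k d g x \<in> set (clusters k)"
  unfolding clusters_def set_n_lists by auto

section \<open>Linearity of the inner projection\<close>

lemma scalar_prod_sum_lessThan:
  fixes u v :: "real vec"
  shows "v \<in> carrier_vec d \<Longrightarrow> u \<bullet> v = (\<Sum>j<d. u $ j * v $ j)"
  by (simp add: scalar_prod_def atLeast0LessThan)

lemma inner_proj_index:
  fixes x :: "real vec"
  assumes "x \<in> carrier_vec d" "i < D"
  shows "inner_proj D d s x $ i = (if D = d then x $ i else (\<Sum>j<d. s (i, j) * x $ j) / sqrt (real D))"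
proof -
  have "row (mat D d s) i = vec d (\<lambda>j. s (i, j))"
    using assms(2) by (intro eq_vecI) auto
  then show ?thesis
    using assms row_scalar_prod[of x d s i] by (simp add: inner_proj_def mult_mat_vec_def)
qed

text \<open>The combination is given coordinatewise, so that the same statement covers query blocks
  (all coefficients 1), document averages and filled blocks, and both the identity and the sign
  matrix.\<close>

lemma inner_proj_linear:
  fixes x :: "real vec" and f :: "'a \<Rightarrow> real vec"
  assumes "finite A" "\<And>a. a \<in> A \<Longrightarrow> f a \<in> carrier_vec d" "x \<in> carrier_vec d"
    and x: "\<And>j. j < d \<Longrightarrow> x $ j = (\<Sum>a\<in>A. c a * f a $ j)" and i: "i < D"
  shows "inner_proj D d s x $ i = (\<Sum>a\<in>A. c a * inner_proj D d s (f a) $ i)"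
proof -
  note index = inner_proj_index[OF assms(3) i] inner_proj_index[OF assms(2) i]
  show ?thesis
  proof (cases "D = d")
    case True
    have "inner_proj D d s (f a) $ i = f a $ i" if "a \<in> A" for a
      using index(2)[OF that] True by simp
    then have "(\<Sum>a\<in>A. c a * inner_proj D d s (f a) $ i) = (\<Sum>a\<in>A. c a * f a $ i)"
      by (intro sum.cong) auto
    then show ?thesis using x[of i] i index(1) True by simp
  next
    case False
    have "(\<Sum>j<d. s (i, j) * x $ j) = (\<Sum>j<d. \<Sum>a\<in>A. c a * (s (i, j) * f a $ j))"
      by (intro sum.cong refl) (simp add: x sum_distrib_left mult_ac)
    also have "\<dots> = (\<Sum>a\<in>A. \<Sum>j<d. c a * (s (i, j) * f a $ j))"
      by (rule sum.swap)
    also have "\<dots> = (\<Sum>a\<in>A. c a * (\<Sum>j<d. s (i, j) * f a $ j))"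
      by (simp only: sum_distrib_left)
    finally show ?thesis
      using False by (simp add: index sum_divide_distrib[symmetric])
  qed
qed

definition proj_prod :: "nat \<Rightarrow> nat \<Rightarrow> array \<Rightarrow> real vec \<Rightarrow> real vec \<Rightarrow> real" where
  "proj_prod D d s x y = inner_proj D d s x \<bullet> inner_proj D d s y"

lemma proj_prod_sum:
  "y \<in> carrier_vec d \<Longrightarrow> proj_prod D d s x y = (\<Sum>i<D. inner_proj D d s x $ i * inner_proj D d s y $ i)"
  by (simp add: proj_prod_def scalar_prod_def dim_inner_proj atLeast0LessThan)

lemma proj_prod_eq:
  fixes x y :: "real vec"
  assumes "x \<in> carrier_vec d" "y \<in> carrier_vec d"
  shows "proj_prod D d s x y =
    (if D = d then x \<bullet> y
     else (\<Sum>i<D. (\<Sum>j<d. s (i, j) * x $ j) * (\<Sum>j<d. s (i, j) * y $ j)) / real D)"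
  using assms by (simp add: proj_prod_sum inner_proj_index scalar_prod_sum_lessThan sum_divide_distrib[symmetric])

lemma proj_prod_linear_left:
  fixes x y :: "real vec" and f :: "'a \<Rightarrow> real vec"
  assumes "finite A" "\<And>a. a \<in> A \<Longrightarrow> f a \<in> carrier_vec d" "x \<in> carrier_vec d" "y \<in> carrier_vec d"
    and "\<And>j. j < d \<Longrightarrow> x $ j = (\<Sum>a\<in>A. c a * f a $ j)"
  shows "proj_prod D d s x y = (\<Sum>a\<in>A. c a * proj_prod D d s (f a) y)"
proof -
  have "proj_prod D d s x y = (\<Sum>i<D. \<Sum>a\<in>A. c a * (inner_proj D d s (f a) $ i * inner_proj D d s y $ i))"
    unfolding proj_prod_sum[OF assms(4)]
    by (intro sum.cong refl) (simp add: inner_proj_linear[OF assms(1-3,5)] sum_distrib_right mult.assoc)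
  then show ?thesis
    using assms(4) by (subst (asm) sum.swap) (simp add: proj_prod_sum sum_distrib_left)
qed

lemma proj_prod_commute:
  "x \<in> carrier_vec d \<Longrightarrow> y \<in> carrier_vec d \<Longrightarrow> proj_prod D d s x y = proj_prod D d s y x"
  by (simp add: proj_prod_sum mult.commute)

text \<open>These are the coefficients of the document block as a convex combination of P: uniform
  on the cluster, or a point mass at the filling point. They absorb the case distinction between
  nonempty and empty clusters.\<close>

definition doc_weight ::
  "(real vec \<Rightarrow> bool list) \<Rightarrow> (bool list \<Rightarrow> real vec) \<Rightarrow> real vec set \<Rightarrow> bool list \<Rightarrow> real vec \<Rightarrow> real" where
  "doc_weight \<phi> fill P b p =
     (let A = {p\<in>P. \<phi> p = b} in if A = {} then of_bool (fill b = p) else of_bool (\<phi> p = b) / real (card A))"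

lemma doc_weight_nonempty:
  "{p\<in>P. \<phi> p = b} \<noteq> {} \<Longrightarrow>
    doc_weight \<phi> fill P b p = of_bool (\<phi> p = b) / real (card {p\<in>P. \<phi> p = b})"
  unfolding doc_weight_def Let_def by (rule if_not_P)

lemma doc_weight_nonneg: "0 \<le> doc_weight \<phi> fill P b p"
  by (simp add: doc_weight_def Let_def)

lemma sum_doc_weight:
  assumes "finite P" "fill b \<in> P"
  shows "(\<Sum>p\<in>P. doc_weight \<phi> fill P b p * f p) =
    (let A = {p\<in>P. \<phi> p = b} in if A = {} then f (fill b) else (\<Sum>p\<in>A. f p) / real (card A))"
proof (cases "{p\<in>P. \<phi> p = b} = {}")
  case True
  have "(\<Sum>p\<in>P. doc_weight \<phi> fill P b p * f p) = (\<Sum>p\<in>P. if fill b = p then f p else 0)"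
    using True by (intro sum.cong) (simp_all add: doc_weight_def)
  then show ?thesis using True assms by simp
next
  case False
  have "(\<Sum>p\<in>P. doc_weight \<phi> fill P b p * f p) =
      (\<Sum>p\<in>P. if \<phi> p = b then f p / real (card {p\<in>P. \<phi> p = b}) else 0)"
    by (intro sum.cong refl) (simp add: doc_weight_nonempty[OF False])
  also have "\<dots> = (\<Sum>p\<in>{p\<in>P. \<phi> p = b}. f p / real (card {p\<in>P. \<phi> p = b}))"
    using assms(1) by (simp add: sum.If_cases Int_def)
  finally show ?thesis
    unfolding Let_def if_not_P[OF False] sum_divide_distrib .
qed

lemma sum_doc_weight_eq_1:
  assumes "finite P" "fill b \<in> P"
  shows "(\<Sum>p\<in>P. doc_weight \<phi> fill P b p) = 1"
proof -
  have "card {p\<in>P. \<phi> p = b} \<noteq> 0" if "{p\<in>P. \<phi> p = b} \<noteq> {}"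
    using assms(1) that by simp
  then show ?thesis
    using sum_doc_weight[of P fill b, OF assms, of \<phi> "\<lambda>_. 1"] by (auto simp: Let_def split: if_splits)
qed

lemma doc_block_carrier:
  assumes "P \<subseteq> carrier_vec d" "fill b \<in> P"
  shows "doc_block d \<phi> fill P b \<in> carrier_vec d"
  unfolding doc_block_def Let_def using assms
  by (auto intro!: finsum_vec_closed smult_carrier_vec[THEN iffD2])

lemma query_block_carrier: "Q \<subseteq> carrier_vec d \<Longrightarrow> query_block d \<phi> Q b \<in> carrier_vec d"
  unfolding query_block_def by (intro finsum_vec_closed) auto

lemma doc_block_index:
  assumes "finite P" "P \<subseteq> carrier_vec d" "fill b \<in> P" "j < d"
  shows "doc_block d \<phi> fill P b $ j = (\<Sum>p\<in>P. doc_weight \<phi> fill P b p * p $ j)"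
proof -
  let ?A = "{p\<in>P. \<phi> p = b}"
  have A: "(\<lambda>p. p) \<in> ?A \<rightarrow> carrier_vec d" using assms by auto
  have "finsum_vec TYPE(real) d (\<lambda>p. p) ?A $ j = (\<Sum>p\<in>?A. p $ j)"
    using assms A by (intro index_finsum_vec) auto
  moreover have "dim_vec (finsum_vec TYPE(real) d (\<lambda>p. p) ?A) = d"
    using finsum_vec_closed[OF A] by auto
  ultimately show ?thesis
    unfolding sum_doc_weight[of P fill b, OF assms(1,3)] doc_block_def Let_def using assms(4)
    by (cases "?A = {}") (simp_all only: if_P if_not_P index_smult_vec, simp)
qed

text \<open>Every query point contributes to exactly one block, so the sum over all clusters
  regroups into a sum over Q in which q meets only the document block of its own code.\<close>

lemma fde_scalar_prod:
  assumes Q: "finite Q" "Q \<subseteq> carrier_vec d" and P: "finite P" "P \<subseteq> carrier_vec d"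
    and fill: "\<And>b. b \<in> set (clusters k) \<Longrightarrow> fill 0 (fst (\<omega> 0)) b \<in> P"
  shows "fde_query k D 1 d \<omega> Q \<bullet> fde_doc k D 1 d fill \<omega> P =
    (\<Sum>q\<in>Q. \<Sum>p\<in>P. doc_weight (simhash k d (fst (\<omega> 0))) (fill 0 (fst (\<omega> 0))) P (simhash k d (fst (\<omega> 0)) q) p *
       proj_prod D d (snd (\<omega> 0)) q p)"
proof -
  obtain g s where \<omega>: "\<omega> 0 = (g, s)" by fastforce
  let ?\<phi> = "simhash k d g" and ?fill = "fill 0 g"
  have fill': "?fill b \<in> P" if "b \<in> set (clusters k)" for b using fill[OF that] \<omega> by simp
  let ?qb = "query_block d ?\<phi> Q" and ?pb = "doc_block d ?\<phi> ?fill P"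
  have qb: "?qb b \<in> carrier_vec d" for b using Q by (intro query_block_carrier)
  have pb: "?pb b \<in> carrier_vec d" if "b \<in> set (clusters k)" for b
    using P fill'[OF that] by (intro doc_block_carrier)
  have "fde_query k D 1 d \<omega> Q \<bullet> fde_doc k D 1 d fill \<omega> P =
      concat_vec (map (\<lambda>b. inner_proj D d s (?qb b)) (clusters k)) \<bullet>
      concat_vec (map (\<lambda>b. inner_proj D d s (?pb b)) (clusters k))"
    by (simp add: fde_query_def fde_doc_def \<omega> concat_vec_singleton)
  also have "\<dots> = (\<Sum>b\<leftarrow>clusters k. proj_prod D d s (?qb b) (?pb b))"
    unfolding proj_prod_def using qb pb by (intro scalar_prod_concat_vec) (simp add: dim_inner_proj)
  also have "\<dots> = (\<Sum>b\<in>set (clusters k). proj_prod D d s (?qb b) (?pb b))"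
    by (simp add: sum_list_distinct_conv_sum_set distinct_clusters)
  also have "\<dots> = (\<Sum>b\<in>set (clusters k). \<Sum>q\<in>{q\<in>Q. ?\<phi> q = b}. proj_prod D d s q (?pb (?\<phi> q)))"
  proof (intro sum.cong refl)
    fix b assume b: "b \<in> set (clusters k)"
    have A: "(\<lambda>q. q) \<in> {q\<in>Q. ?\<phi> q = b} \<rightarrow> carrier_vec d" using Q by auto
    have "?qb b $ j = (\<Sum>q\<in>{q\<in>Q. ?\<phi> q = b}. 1 * q $ j)" if "j < d" for j
      unfolding query_block_def using Q that A by (subst index_finsum_vec) auto
    then have "proj_prod D d s (?qb b) (?pb b) = (\<Sum>q\<in>{q\<in>Q. ?\<phi> q = b}. 1 * proj_prod D d s q (?pb b))"
      using Q qb pb[OF b] by (intro proj_prod_linear_left) auto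
    then show "proj_prod D d s (?qb b) (?pb b) = (\<Sum>q\<in>{q\<in>Q. ?\<phi> q = b}. proj_prod D d s q (?pb (?\<phi> q)))"
      by simp
  qed
  also have "\<dots> = (\<Sum>q\<in>Q. proj_prod D d s q (?pb (?\<phi> q)))"
    using Q by (intro sum.group) (auto simp: simhash_in_clusters)
  also have "\<dots> = (\<Sum>q\<in>Q. \<Sum>p\<in>P. doc_weight ?\<phi> ?fill P (?\<phi> q) p * proj_prod D d s q p)"
  proof (intro sum.cong refl)
    fix q assume q: "q \<in> Q"
    let ?b = "?\<phi> q"
    have b: "?b \<in> set (clusters k)" by (rule simhash_in_clusters)
    have qd: "q \<in> carrier_vec d" using q Q by auto
    have "proj_prod D d s (?pb ?b) q = (\<Sum>p\<in>P. doc_weight ?\<phi> ?fill P ?b p * proj_prod D d s p q)"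
      using P pb[OF b] qd doc_block_index[of P d ?fill ?b, OF P fill'[OF b]] by (intro proj_prod_linear_left) auto
    also have "\<dots> = (\<Sum>p\<in>P. doc_weight ?\<phi> ?fill P ?b p * proj_prod D d s q p)"
      using P qd by (intro sum.cong refl) (metis proj_prod_commute subsetD)
    finally show "proj_prod D d s q (?pb ?b) = (\<Sum>p\<in>P. doc_weight ?\<phi> ?fill P ?b p * proj_prod D d s q p)"
      using proj_prod_commute[OF qd pb[OF b]] by simp
  qed
  finally show ?thesis by (simp add: \<omega>)
qed

section \<open>From Hamming distances through angles to inner products\<close>

lemma cos_diff_le: "\<bar>cos x - cos y\<bar> \<le> \<bar>x - (y :: real)\<bar>"
proof -
  have "\<bar>cos x - cos y\<bar> = 2 * (\<bar>sin ((x + y) / 2)\<bar> * \<bar>sin ((y - x) / 2)\<bar>)"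
    by (simp add: cos_diff_cos abs_mult)
  also have "\<dots> \<le> 2 * (1 * \<bar>(y - x) / 2\<bar>)"
    by (intro mult_left_mono mult_mono abs_sin_le_one abs_sin_x_le_abs_x) auto
  finally show ?thesis by (simp add: abs_minus_commute)
qed

text \<open>The cosine is 1-Lipschitz, so an angle error of t costs at most t in the inner product,
  also near -1 and 1, where the slope of arccos is unbounded.\<close>

lemma arccos_le_imp_ge:
  assumes "\<bar>a\<bar> \<le> 1" "\<bar>b\<bar> \<le> 1" "arccos a \<le> arccos b + t" "0 \<le> t"
  shows "b - t \<le> a"
proof (cases "arccos a \<le> arccos b")
  case True
  then have "b \<le> a" using assms by (simp add: arccos_le_mono)
  with assms show ?thesis by simp
next
  case False
  have "cos (arccos a) = a" "cos (arccos b) = b" using assms by (auto simp: abs_le_iff)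
  with cos_diff_le[of "arccos a" "arccos b"] False assms(3) show ?thesis by linarith
qed

lemma abs_scalar_prod_unit_le:
  fixes x y :: "real vec"
  assumes "x \<in> carrier_vec d" "y \<in> carrier_vec d" "x \<bullet> x = 1" "y \<bullet> y = 1"
  shows "\<bar>x \<bullet> y\<bar> \<le> 1"
proof -
  have "\<bar>x \<bullet> y\<bar> \<le> (\<Sum>j<d. ((x $ j)\<^sup>2 + (y $ j)\<^sup>2) / 2)"
    unfolding scalar_prod_sum_lessThan[OF assms(2)]
  proof (rule order_trans[OF sum_abs], rule sum_mono)
    fix j
    show "\<bar>x $ j * y $ j\<bar> \<le> ((x $ j)\<^sup>2 + (y $ j)\<^sup>2) / 2"
      using sum_squares_bound[of "\<bar>x $ j\<bar>" "\<bar>y $ j\<bar>"] by (simp add: abs_mult)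
  qed
  also have "\<dots> = (x \<bullet> x + y \<bullet> y) / 2"
    unfolding scalar_prod_sum_lessThan[OF assms(1)] scalar_prod_sum_lessThan[OF assms(2)]
    by (simp add: sum_divide_distrib[symmetric] sum.distrib power2_eq_square)
  finally show ?thesis using assms by simp
qed

text \<open>A nonempty cluster puts weight only on points at distance zero, an empty one only on a
  minimizer. This is why empty document clusters are filled with a nearest point.\<close>

lemma doc_weight_imp_hamming_le:
  assumes "finite P" "p \<in> P" "p' \<in> P" "doc_weight \<phi> fill P b p \<noteq> 0"
    and "is_arg_min (\<lambda>p. hamming (\<phi> p) b) (\<lambda>p. p \<in> P) (fill b)"
  shows "hamming (\<phi> p) b \<le> hamming (\<phi> p') b"
proof (cases "{p\<in>P. \<phi> p = b} = {}")
  case True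
  then have "fill b = p" using assms(4) by (simp add: doc_weight_def)
  with assms(3,5) show ?thesis by (auto simp: is_arg_min_def not_less)
next
  case False
  then have "\<phi> p = b" using assms(4) by (simp add: doc_weight_nonempty)
  then show ?thesis by (simp add: hamming_def)
qed

lemma close_trans:
  fixes a b u v e :: real
  assumes "a \<le> b" "\<bar>a - u\<bar> < e" "\<bar>b - v\<bar> < e"
  shows "u < v + 2 * e"
  using assms by linarith

text \<open>A convex combination never exceeds the maximum, whatever the partition. Conversely, a
  point with positive weight is at least as close in Hamming distance as the true maximizer; the
  error enters once for each of the two points, which gives the angle error
  \<open>2 * pi * \<eta>\<close>.\<close>

lemma sum_doc_weight_bounds:
  assumes P: "finite P" "P \<noteq> {}" "P \<subseteq> carrier_vec d" "\<And>p. p \<in> P \<Longrightarrow> p \<bullet> p = 1"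
    and q: "q \<in> carrier_vec d" "q \<bullet> q = 1" and k: "0 < k"
    and fill: "is_arg_min (\<lambda>p. hamming (\<phi> p) (\<phi> q)) (\<lambda>p. p \<in> P) (fill (\<phi> q))"
  shows "(\<Sum>p\<in>P. doc_weight \<phi> fill P (\<phi> q) p * (q \<bullet> p)) \<le> Max ((\<lambda>p. q \<bullet> p) ` P)"
    and "(\<And>p. p \<in> P \<Longrightarrow>
         \<bar>real (hamming (\<phi> p) (\<phi> q)) - real k * (arccos (p \<bullet> q) / pi)\<bar> < real k * \<eta>) \<Longrightarrow>
       Max ((\<lambda>p. q \<bullet> p) ` P) - 2 * pi * \<eta> \<le> (\<Sum>p\<in>P. doc_weight \<phi> fill P (\<phi> q) p * (q \<bullet> p))"
proof -
  let ?w = "doc_weight \<phi> fill P (\<phi> q)" and ?M = "Max ((\<lambda>p. q \<bullet> p) ` P)"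
  have fillP: "fill (\<phi> q) \<in> P" using fill by (simp add: is_arg_min_def)
  have w1: "(\<Sum>p\<in>P. ?w p * c) = c" for c
    using sum_doc_weight_eq_1[of P fill "\<phi> q", OF P(1) fillP] by (simp add: sum_distrib_right[symmetric])
  have "(\<Sum>p\<in>P. ?w p * (q \<bullet> p)) \<le> (\<Sum>p\<in>P. ?w p * ?M)"
    using P(1) by (intro sum_mono mult_left_mono doc_weight_nonneg Max_ge) auto
  then show "(\<Sum>p\<in>P. ?w p * (q \<bullet> p)) \<le> ?M" unfolding w1 .
  assume close: "\<And>p. p \<in> P \<Longrightarrow>
      \<bar>real (hamming (\<phi> p) (\<phi> q)) - real k * (arccos (p \<bullet> q) / pi)\<bar> < real k * \<eta>"
  \<comment> \<open>The strict closeness assumption, applied to the filling point, forces \<eta> to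
    be positive.\<close>
  have "0 < real k * \<eta>" using close[OF fillP] by linarith
  then have \<eta>: "0 < \<eta>" using k by (simp add: zero_less_mult_iff)
  have "?M \<in> (\<lambda>p. q \<bullet> p) ` P" using P by (intro Max_in) auto
  then obtain r where r: "r \<in> P" "?M = q \<bullet> r" by auto
  have comm: "p \<bullet> q = q \<bullet> p" if "p \<in> P" for p
    using that P q by (intro comm_scalar_prod[of _ d]) auto
  have "?w p * (?M - 2 * pi * \<eta>) \<le> ?w p * (q \<bullet> p)" if p: "p \<in> P" for p
  proof (cases "?w p = 0")
    case False
    have "hamming (\<phi> p) (\<phi> q) \<le> hamming (\<phi> r) (\<phi> q)"
      by (rule doc_weight_imp_hamming_le[OF P(1) p r(1) False fill])
    then have "real k * (arccos (p \<bullet> q) / pi) < real k * (arccos (r \<bullet> q) / pi) + 2 * (real k * \<eta>)"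
      using close[OF p] close[OF r(1)] by (intro close_trans[of "real (hamming (\<phi> p) (\<phi> q))"]) auto
    then have "real k * (arccos (p \<bullet> q) / pi) < real k * (arccos (r \<bullet> q) / pi + 2 * \<eta>)"
      by (simp add: algebra_simps)
    then have "arccos (p \<bullet> q) / pi < arccos (r \<bullet> q) / pi + 2 * \<eta>"
      by (rule mult_left_less_imp_less) simp
    then have "arccos (p \<bullet> q) < arccos (r \<bullet> q) + 2 * pi * \<eta>"
      by (simp add: field_simps)
    moreover have "\<bar>p \<bullet> q\<bar> \<le> 1" "\<bar>r \<bullet> q\<bar> \<le> 1"
      using p r P q by (auto intro!: abs_scalar_prod_unit_le[of _ d])
    ultimately have "r \<bullet> q - 2 * pi * \<eta> \<le> p \<bullet> q"
      using \<eta> by (intro arccos_le_imp_ge) auto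
    then show ?thesis
      using comm[OF p] comm[OF r(1)] r by (intro mult_left_mono doc_weight_nonneg) auto
  qed simp
  then have "(\<Sum>p\<in>P. ?w p * (?M - 2 * pi * \<eta>)) \<le> (\<Sum>p\<in>P. ?w p * (q \<bullet> p))"
    by (rule sum_mono)
  then show "?M - 2 * pi * \<eta> \<le> (\<Sum>p\<in>P. ?w p * (q \<bullet> p))" unfolding w1 .
qed

section \<open>The approximation guarantee\<close>

lemma measurable_simhash_row:
  assumes "i < k"
  shows "(\<lambda>g. \<Sum>j<d. g (i, j) * x $ j) \<in> borel_measurable (gauss_space k d)"
  unfolding gauss_space_def
proof (intro borel_measurable_sum borel_measurable_times borel_measurable_const)
  fix j assume "j \<in> {..<d}"
  with assms have "(i, j) \<in> {..<k} \<times> {..<d}" by auto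
  from measurable_component_singleton[OF this, of "\<lambda>_. std_gauss"]
  show "(\<lambda>g. g (i, j)) \<in> borel_measurable (PiM ({..<k} \<times> {..<d}) (\<lambda>_. std_gauss))"
    by simp
qed

lemma measurable_simhash:
  assumes x: "x \<in> carrier_vec d"
  shows "(\<lambda>g. simhash k d g x) \<in> measurable (gauss_space k d) (count_space UNIV)"
proof -
  have "(\<lambda>g. simhash k d g x) -` {b} \<inter> space (gauss_space k d) \<in> sets (gauss_space k d)" for b
  proof (cases "length b = k")
    case True
    have "(\<lambda>g. simhash k d g x) -` {b} \<inter> space (gauss_space k d) =
        {g \<in> space (gauss_space k d). \<forall>i\<in>{..<k}. (0 < (\<Sum>j<d. g (i, j) * x $ j)) = b ! i}"
      using True x by (auto simp: list_eq_iff_nth_eq nth_simhash)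
    also have "\<dots> \<in> sets (gauss_space k d)"
    proof (intro sets.sets_Collect_finite_All)
      fix i assume i: "i \<in> {..<k}"
      have [measurable]: "(\<lambda>g. \<Sum>j<d. g (i, j) * x $ j) \<in> borel_measurable (gauss_space k d)"
        using i by (intro measurable_simhash_row) auto
      show "{g \<in> space (gauss_space k d). (0 < (\<Sum>j<d. g (i, j) * x $ j)) = b ! i} \<in> sets (gauss_space k d)"
        by measurable
    qed simp
    finally show ?thesis .
  next
    case False
    then have "(\<lambda>g. simhash k d g x) -` {b} = {}" by auto
    then show ?thesis by simp
  qed
  then show ?thesis
    by (simp add: measurable_count_space_eq2_countable)
qed

section \<open>The weights, the estimate and the failure events of one repetition\<close>

locale fde_setup =
  fixes k D d :: nat and Q P :: "real vec set" and fill :: "nat \<Rightarrow> array \<Rightarrow> bool list \<Rightarrow> real vec"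
  assumes Q: "unit_vec_set d Q" and P: "unit_vec_set d P"
    and k_pos: "0 < k" and D_pos: "0 < D"
    and tie: "tie_breaking k 1 d P fill"
begin

definition w :: "array \<Rightarrow> real vec \<Rightarrow> real vec \<Rightarrow> real" where
  "w g q p = doc_weight (simhash k d g) (fill 0 g) P (simhash k d g q) p"

definition estimate :: "array \<times> array \<Rightarrow> real" where
  "estimate x = (\<Sum>q\<in>Q. \<Sum>p\<in>P. w (fst x) q p * proj_prod D d (snd x) q p) / real (card Q)"

definition part_estimate :: "array \<Rightarrow> real" where
  "part_estimate g = (\<Sum>q\<in>Q. \<Sum>p\<in>P. w g q p * (q \<bullet> p)) / real (card Q)"

definition bad_part :: "real \<Rightarrow> array set" where
  "bad_part \<eta> = (\<Union>q\<in>Q. \<Union>p\<in>P. {g \<in> space (gauss_space k d).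
     real k * \<eta> \<le> \<bar>real (hamming (simhash k d g p) (simhash k d g q)) - real k * (arccos (p \<bullet> q) / pi)\<bar>})"

definition bad_proj :: "real \<Rightarrow> array set" where
  "bad_proj \<eta> = (\<Union>q\<in>Q. \<Union>p\<in>P. {s \<in> space (sign_space D d). \<eta> \<le> \<bar>proj_prod D d s q p - q \<bullet> p\<bar>})"

lemma finite_QP: "finite Q" "finite P" "Q \<noteq> {}" "P \<noteq> {}" "0 < real (card Q)"
  using Q P by (auto simp: unit_vec_set_def card_gt_0_iff)

lemma carrier_QP: "Q \<subseteq> carrier_vec d" "P \<subseteq> carrier_vec d"
  using Q P by (auto simp: unit_vec_set_def)

lemma unit_QP: "q \<in> Q \<Longrightarrow> q \<bullet> q = 1" "p \<in> P \<Longrightarrow> p \<bullet> p = 1"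
  using Q P by (auto simp: unit_vec_set_def)

lemma in_carrier: "q \<in> Q \<Longrightarrow> q \<in> carrier_vec d" "p \<in> P \<Longrightarrow> p \<in> carrier_vec d"
  using carrier_QP by auto

sublocale G: prob_space "gauss_space k d" by (rule prob_space_gauss_space)
sublocale S: prob_space "sign_space D d" by (rule prob_space_sign_space)
sublocale GS: pair_prob_space "gauss_space k d" "sign_space D d" ..

lemma fill_arg_min:
  assumes "g \<in> space (gauss_space k d)" "b \<in> set (clusters k)"
  shows "is_arg_min (\<lambda>p. hamming (simhash k d g p) b) (\<lambda>p. p \<in> P) (fill 0 g b)"
  using tie assms unfolding tie_breaking_def by auto

lemma fill_in_P: "g \<in> space (gauss_space k d) \<Longrightarrow> b \<in> set (clusters k) \<Longrightarrow> fill 0 g b \<in> P"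
  using fill_arg_min by (auto simp: is_arg_min_def)

lemma w_nonneg: "0 \<le> w g q p"
  by (simp add: w_def doc_weight_nonneg)

lemma sum_w: "g \<in> space (gauss_space k d) \<Longrightarrow> (\<Sum>p\<in>P. w g q p) = 1"
  unfolding w_def using finite_QP fill_in_P[OF _ simhash_in_clusters]
  by (intro sum_doc_weight_eq_1) auto

lemma w_le_1: "g \<in> space (gauss_space k d) \<Longrightarrow> p \<in> P \<Longrightarrow> w g q p \<le> 1"
  using member_le_sum[of p P "w g q"] finite_QP by (auto simp: sum_w w_nonneg)

text \<open>The weight belongs to a random cluster. Splitting over the countably many codes of q
  leaves a fixed cluster, whose weights are built from code indicators and the tie-breaking
  rule.\<close>

lemma borel_measurable_w [measurable]:
  assumes q: "q \<in> Q" and p: "p \<in> P"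
  shows "(\<lambda>g. w g q p) \<in> borel_measurable (gauss_space k d)"
proof -
  let ?G = "gauss_space k d"
  define a where "a = (\<lambda>b p' g. of_bool (simhash k d g p' = b) :: real)"
  have a: "a b p' \<in> borel_measurable ?G" if "p' \<in> P" for b p'
    unfolding a_def
    by (rule measurable_compose[OF measurable_simhash[OF in_carrier(2)[OF that]]]) simp
  \<comment> \<open>Emptiness of the cluster is expressed by a vanishing sum of indicators. The
    outer guard is there because the tie-breaking rule is a random variable only at genuine
    clusters, while b ranges over all Boolean lists.\<close>
  define f where "f = (\<lambda>b g. if b \<in> set (clusters k) then
     (if (\<Sum>p'\<in>P. a b p' g) = 0 then of_bool (fill 0 g b = p) else a b p g / (\<Sum>p'\<in>P. a b p' g)) else 0)"
  have f: "f b \<in> borel_measurable ?G" for b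
  proof (cases "b \<in> set (clusters k)")
    case True
    have sum: "(\<lambda>g. \<Sum>p'\<in>P. a b p' g) \<in> borel_measurable ?G"
      using a by (intro borel_measurable_sum)
    have "(\<lambda>g. fill 0 g b) \<in> measurable ?G (count_space P)"
      using tie True unfolding tie_breaking_def by auto
    then have "(\<lambda>g. of_bool (fill 0 g b = p) :: real) \<in> borel_measurable ?G"
      by (rule measurable_compose) simp
    then show ?thesis
      using True sum a[OF p] unfolding f_def
      by (auto intro!: measurable_If borel_measurable_divide)
  next
    case False
    then show ?thesis by (simp add: f_def)
  qed
  have "(\<lambda>g. f (simhash k d g q) g) \<in> borel_measurable ?G"
    by (rule measurable_compose_countable[OF f measurable_simhash[OF in_carrier(1)[OF q]]])
  moreover have "w g q p = f (simhash k d g q) g" for g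
  proof -
    let ?b = "simhash k d g q" and ?A = "{p'\<in>P. simhash k d g p' = simhash k d g q}"
    have sum: "(\<Sum>p'\<in>P. a ?b p' g) = real (card ?A)"
      using finite_QP by (simp add: a_def Int_def)
    have "(real (card ?A) = 0) = (?A = {})" using finite_QP by simp
    then show ?thesis
      unfolding f_def w_def doc_weight_def Let_def sum using simhash_in_clusters[of k d g q]
      by (simp only: if_True a_def)
  qed
  ultimately show ?thesis by simp
qed

lemma borel_measurable_proj_prod [measurable]:
  assumes "q \<in> Q" "p \<in> P"
  shows "(\<lambda>s. proj_prod D d s q p) \<in> borel_measurable (sign_space D d)"
proof (cases "D = d")
  case True
  show ?thesis
    unfolding proj_prod_eq[OF in_carrier(1)[OF assms(1)] in_carrier(2)[OF assms(2)]] if_P[OF True]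
    by (rule borel_measurable_const)
next
  case False
  then show ?thesis
    unfolding proj_prod_eq[OF in_carrier(1)[OF assms(1)] in_carrier(2)[OF assms(2)]] if_not_P[OF False]
    by (intro borel_measurable_divide borel_measurable_sum borel_measurable_times measurable_sign_row) auto
qed

lemma integrable_proj_prod:
  assumes "q \<in> Q" "p \<in> P"
  shows "integrable (sign_space D d) (\<lambda>s. proj_prod D d s q p)"
proof (cases "D = d")
  case True
  show ?thesis
    unfolding proj_prod_eq[OF in_carrier(1)[OF assms(1)] in_carrier(2)[OF assms(2)]] if_P[OF True]
    by simp
next
  case False
  then show ?thesis
    unfolding proj_prod_eq[OF in_carrier(1)[OF assms(1)] in_carrier(2)[OF assms(2)]] if_not_P[OF False]
    by (intro integrable_divide Bochner_Integration.integrable_sum integrable_sign_row) auto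
qed

lemma expectation_proj_prod:
  assumes "q \<in> Q" "p \<in> P"
  shows "(\<integral>s. proj_prod D d s q p \<partial>sign_space D d) = q \<bullet> p"
proof (cases "D = d")
  case True
  show ?thesis
    unfolding proj_prod_eq[OF in_carrier(1)[OF assms(1)] in_carrier(2)[OF assms(2)]] if_P[OF True]
    by (simp add: S.prob_space)
next
  case False
  have "(\<integral>s. proj_prod D d s q p \<partial>sign_space D d) = (\<Sum>i<D. q \<bullet> p) / real D"
    unfolding proj_prod_eq[OF in_carrier(1)[OF assms(1)] in_carrier(2)[OF assms(2)]] if_not_P[OF False]
    using assms in_carrier
    by (simp add: Bochner_Integration.integral_sum integrable_sign_row integral_sign_row
      scalar_prod_sum_lessThan[OF in_carrier(2)[OF assms(2)]])
  then show ?thesis using D_pos by simp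
qed

lemma measure_UN_QP_le:
  assumes "finite_measure M" "\<And>q p. q \<in> Q \<Longrightarrow> p \<in> P \<Longrightarrow> A q p \<in> sets M"
    "\<And>q p. q \<in> Q \<Longrightarrow> p \<in> P \<Longrightarrow> measure M (A q p) \<le> c"
  shows "measure M (\<Union>q\<in>Q. \<Union>p\<in>P. A q p) \<le> real (card Q) * real (card P) * c"
proof -
  interpret finite_measure M by fact
  have "measure M (\<Union>q\<in>Q. \<Union>p\<in>P. A q p) \<le> (\<Sum>q\<in>Q. measure M (\<Union>p\<in>P. A q p))"
    using assms(2) finite_QP by (intro finite_measure_subadditive_finite) auto
  also have "\<dots> \<le> (\<Sum>q\<in>Q. \<Sum>p\<in>P. measure M (A q p))"
    using assms(2) finite_QP by (intro sum_mono finite_measure_subadditive_finite) auto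
  also have "\<dots> \<le> (\<Sum>q\<in>Q. \<Sum>p\<in>P. c)"
    by (intro sum_mono assms(3))
  finally show ?thesis by (simp add: mult.assoc)
qed

lemma sets_bad_part_aux:
  assumes "q \<in> Q" "p \<in> P"
  shows "{g \<in> space (gauss_space k d). real k * \<eta> \<le>
    \<bar>real (hamming (simhash k d g p) (simhash k d g q)) - real k * (arccos (p \<bullet> q) / pi)\<bar>} \<in> sets (gauss_space k d)"
proof -
  have "(\<lambda>g. real (hamming (simhash k d g p) (simhash k d g q))) \<in> borel_measurable (gauss_space k d)"
    unfolding real_hamming_simhash[OF in_carrier(2)[OF assms(2)] in_carrier(1)[OF assms(1)]]
  proof (rule borel_measurable_sum)
    fix i assume i: "i \<in> {..<k}"
    then have [measurable]: "(\<lambda>g. \<Sum>j<d. g (i, j) * x $ j) \<in> borel_measurable (gauss_space k d)" for x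
      by (intro measurable_simhash_row) auto
    show "(\<lambda>g. of_bool ((0 < (\<Sum>j<d. g (i, j) * p $ j)) \<noteq> (0 < (\<Sum>j<d. g (i, j) * q $ j))) :: real)
        \<in> borel_measurable (gauss_space k d)"
      by measurable
  qed
  note this[measurable]
  show ?thesis by measurable
qed

lemma sets_bad_part: "bad_part \<eta> \<in> sets (gauss_space k d)"
  unfolding bad_part_def by (intro sets.finite_UN finite_QP sets_bad_part_aux)

lemma measure_bad_part:
  assumes "0 \<le> \<eta>"
  shows "measure (gauss_space k d) (bad_part \<eta>) \<le> real (card Q) * real (card P) * (2 * exp (- 2 * real k * \<eta>\<^sup>2))"
  unfolding bad_part_def
proof (rule measure_UN_QP_le[OF G.finite_measure_axioms sets_bad_part_aux])
  fix q p assume "q \<in> Q" "p \<in> P"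
  then show "measure (gauss_space k d) {g \<in> space (gauss_space k d). real k * \<eta> \<le>
      \<bar>real (hamming (simhash k d g p) (simhash k d g q)) - real k * (arccos (p \<bullet> q) / pi)\<bar>} \<le>
      2 * exp (- 2 * real k * \<eta>\<^sup>2)"
    using assms k_pos by (intro simhash_concentration in_carrier unit_QP)
qed

lemma sets_bad_proj_aux:
  assumes "q \<in> Q" "p \<in> P"
  shows "{s \<in> space (sign_space D d). \<eta> \<le> \<bar>proj_prod D d s q p - q \<bullet> p\<bar>} \<in> sets (sign_space D d)"
  using borel_measurable_proj_prod[OF assms] by measurable

lemma sets_bad_proj: "bad_proj \<eta> \<in> sets (sign_space D d)"
  unfolding bad_proj_def by (intro sets.finite_UN finite_QP sets_bad_proj_aux)

lemma measure_bad_proj: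
  assumes \<eta>: "0 < \<eta>" "\<eta> \<le> 1"
  shows "measure (sign_space D d) (bad_proj \<eta>) \<le> real (card Q) * real (card P) * (2 * exp (- real D * \<eta>\<^sup>2 / 8192))"
  unfolding bad_proj_def
proof (rule measure_UN_QP_le[OF S.finite_measure_axioms sets_bad_proj_aux])
  fix q p assume q: "q \<in> Q" and p: "p \<in> P"
  note qp = in_carrier(1)[OF q] in_carrier(2)[OF p]
  show "measure (sign_space D d) {s \<in> space (sign_space D d). \<eta> \<le> \<bar>proj_prod D d s q p - q \<bullet> p\<bar>} \<le>
      2 * exp (- real D * \<eta>\<^sup>2 / 8192)"
  proof (cases "D = d")
    case True
    \<comment> \<open>For equal dimensions \<psi> is the identity, so the projection cannot
      fail.\<close>
    have empty: "{s \<in> space (sign_space D d). \<eta> \<le> \<bar>proj_prod D d s q p - q \<bullet> p\<bar>} = {}"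
      unfolding proj_prod_eq[OF qp] if_P[OF True] using \<eta> by simp
    show ?thesis unfolding empty by simp
  next
    case False
    have eq: "(\<eta> \<le> \<bar>S / real D - q \<bullet> p\<bar>) = (real D * \<eta> \<le> \<bar>S - real D * (\<Sum>j<d. q $ j * p $ j)\<bar>)" for S
    proof -
      have "S - real D * (q \<bullet> p) = real D * (S / real D - q \<bullet> p)"
        using D_pos by (simp add: right_diff_distrib)
      then have "\<bar>S - real D * (q \<bullet> p)\<bar> = real D * \<bar>S / real D - q \<bullet> p\<bar>"
        by (simp only: abs_mult abs_of_nat)
      then show ?thesis using D_pos by (simp add: scalar_prod_sum_lessThan[OF qp(2)])
    qed
    have "(\<Sum>j<d. (q $ j)\<^sup>2) = 1" "(\<Sum>j<d. (p $ j)\<^sup>2) = 1"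
      using unit_QP(1)[OF q] unit_QP(2)[OF p] by (simp_all add: scalar_prod_sum_lessThan[OF qp(1)] scalar_prod_sum_lessThan[OF qp(2)] power2_eq_square)
    from sign_rows_concentration[OF this D_pos \<eta>]
    show ?thesis unfolding proj_prod_eq[OF qp] if_not_P[OF False] eq .
  qed
qed

end

text \<open>The weights depend on the partition alone and the projected products on the projection
  alone; independence of the two lets their expectations be multiplied.\<close>

lemma (in pair_sigma_finite)
  fixes u v :: "_ \<Rightarrow> real"
  assumes u: "integrable M1 u" and v: "integrable M2 v"
  shows integrable_product_function: "integrable (M1 \<Otimes>\<^sub>M M2) (\<lambda>x. u (fst x) * v (snd x))"
    and integral_product_function:
      "(\<integral>x. u (fst x) * v (snd x) \<partial>(M1 \<Otimes>\<^sub>M M2)) = (\<integral>x. u x \<partial>M1) * (\<integral>y. v y \<partial>M2)"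
proof -
  note [measurable] = borel_measurable_integrable[OF u] borel_measurable_integrable[OF v]
  show int: "integrable (M1 \<Otimes>\<^sub>M M2) (\<lambda>x. u (fst x) * v (snd x))"
  proof (rule Fubini_integrable)
    show "integrable M1 (\<lambda>x. \<integral>y. norm (u (fst (x, y)) * v (snd (x, y))) \<partial>M2)"
      using u by (simp add: abs_mult)
    show "AE x in M1. integrable M2 (\<lambda>y. u (fst (x, y)) * v (snd (x, y)))"
      using v by simp
  qed measurable
  show "(\<integral>x. u (fst x) * v (snd x) \<partial>(M1 \<Otimes>\<^sub>M M2)) = (\<integral>x. u x \<partial>M1) * (\<integral>y. v y \<partial>M2)"
    using integral_fst'[OF int] by simp
qed

section \<open>Error and expectation of the estimate\<close>

context fde_setup
begin

lemma part_estimate_le: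
  assumes g: "g \<in> space (gauss_space k d)"
  shows "part_estimate g \<le> nchamfer Q P"
proof -
  have "(\<Sum>p\<in>P. w g q p * (q \<bullet> p)) \<le> Max ((\<lambda>p. q \<bullet> p) ` P)" if q: "q \<in> Q" for q
    unfolding w_def
    by (rule sum_doc_weight_bounds(1)[of P d q k "simhash k d g" "fill 0 g", OF finite_QP(2,4) carrier_QP(2) unit_QP(2) in_carrier(1)[OF q] unit_QP(1)[OF q] k_pos
          fill_arg_min[OF g simhash_in_clusters]])
  then show ?thesis
    unfolding part_estimate_def nchamfer_def chamfer_def by (intro divide_right_mono sum_mono) simp_all
qed

lemma part_estimate_ge:
  assumes g: "g \<in> space (gauss_space k d)" "g \<notin> bad_part \<eta>"
  shows "nchamfer Q P - 2 * pi * \<eta> \<le> part_estimate g"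
proof -
  have "Max ((\<lambda>p. q \<bullet> p) ` P) - 2 * pi * \<eta> \<le> (\<Sum>p\<in>P. w g q p * (q \<bullet> p))" if q: "q \<in> Q" for q
    unfolding w_def
  proof (rule sum_doc_weight_bounds(2)[of P d q k "simhash k d g" "fill 0 g", OF finite_QP(2,4) carrier_QP(2) unit_QP(2) in_carrier(1)[OF q] unit_QP(1)[OF q] k_pos
          fill_arg_min[OF g(1) simhash_in_clusters]])
    fix p assume "p \<in> P"
    with g q show "\<bar>real (hamming (simhash k d g p) (simhash k d g q)) - real k * (arccos (p \<bullet> q) / pi)\<bar> < real k * \<eta>"
      unfolding bad_part_def by (auto simp: not_le)
  qed
  then have "(\<Sum>q\<in>Q. Max ((\<lambda>p. q \<bullet> p) ` P) - 2 * pi * \<eta>) \<le> (\<Sum>q\<in>Q. \<Sum>p\<in>P. w g q p * (q \<bullet> p))"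
    by (rule sum_mono)
  then have "((\<Sum>q\<in>Q. Max ((\<lambda>p. q \<bullet> p) ` P)) - real (card Q) * (2 * pi * \<eta>)) / real (card Q) \<le> part_estimate g"
    unfolding part_estimate_def by (intro divide_right_mono) (simp_all add: sum_subtractf)
  then show ?thesis
    using finite_QP(5) by (simp add: nchamfer_def chamfer_def diff_divide_distrib)
qed

lemma average_le:
  assumes "\<And>q. q \<in> Q \<Longrightarrow> \<bar>f q\<bar> \<le> (c::real)"
  shows "\<bar>(\<Sum>q\<in>Q. f q) / real (card Q)\<bar> \<le> c"
proof -
  have "\<bar>\<Sum>q\<in>Q. f q\<bar> \<le> (\<Sum>q\<in>Q. c)"
    using assms by (intro order_trans[OF sum_abs] sum_mono)
  then show ?thesis using finite_QP(5) by (simp add: abs_divide divide_le_eq mult.commute)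
qed

lemma abs_inner_le: "q \<in> Q \<Longrightarrow> p \<in> P \<Longrightarrow> \<bar>q \<bullet> p\<bar> \<le> 1"
  using abs_scalar_prod_unit_le[OF in_carrier(1) in_carrier(2) unit_QP(1) unit_QP(2)] .

lemma abs_part_estimate_le:
  assumes g: "g \<in> space (gauss_space k d)"
  shows "\<bar>part_estimate g\<bar> \<le> 1"
  unfolding part_estimate_def
proof (rule average_le)
  fix q assume q: "q \<in> Q"
  have "\<bar>\<Sum>p\<in>P. w g q p * (q \<bullet> p)\<bar> \<le> (\<Sum>p\<in>P. w g q p * 1)"
  proof (rule order_trans[OF sum_abs], rule sum_mono)
    fix p assume "p \<in> P"
    then show "\<bar>w g q p * (q \<bullet> p)\<bar> \<le> w g q p * 1"
      unfolding abs_mult using abs_inner_le[OF q] w_nonneg by (intro mult_mono) auto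
  qed
  then show "\<bar>\<Sum>p\<in>P. w g q p * (q \<bullet> p)\<bar> \<le> 1" by (simp add: sum_w[OF g])
qed

lemma nchamfer_le_1: "nchamfer Q P \<le> 1"
proof -
  have "\<bar>nchamfer Q P\<bar> \<le> 1"
    unfolding nchamfer_def chamfer_def
  proof (rule average_le)
    fix q assume q: "q \<in> Q"
    have "Max ((\<lambda>p. q \<bullet> p) ` P) \<in> (\<lambda>p. q \<bullet> p) ` P"
      using finite_QP by (intro Max_in) auto
    then show "\<bar>Max ((\<lambda>p. q \<bullet> p) ` P)\<bar> \<le> 1" using abs_inner_le[OF q] by auto
  qed
  then show ?thesis by simp
qed

text \<open>The weights of each q are nonnegative and sum to 1, so a uniform error in the inner
  products passes to the average without amplification.\<close>

lemma estimate_close: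
  assumes g: "g \<in> space (gauss_space k d)" and s: "s \<in> space (sign_space D d)" "s \<notin> bad_proj \<eta>"
  shows "\<bar>estimate (g, s) - part_estimate g\<bar> \<le> \<eta>"
proof -
  have "estimate (g, s) - part_estimate g =
      (\<Sum>q\<in>Q. \<Sum>p\<in>P. w g q p * (proj_prod D d s q p - q \<bullet> p)) / real (card Q)"
    by (simp add: estimate_def part_estimate_def diff_divide_distrib sum_subtractf right_diff_distrib)
  also have "\<bar>\<dots>\<bar> \<le> \<eta>"
  proof (rule average_le)
    fix q assume q: "q \<in> Q"
    have "\<bar>\<Sum>p\<in>P. w g q p * (proj_prod D d s q p - q \<bullet> p)\<bar> \<le> (\<Sum>p\<in>P. w g q p * \<eta>)"
    proof (rule order_trans[OF sum_abs], rule sum_mono)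
      fix p assume "p \<in> P"
      with s q have "\<bar>proj_prod D d s q p - q \<bullet> p\<bar> \<le> \<eta>"
        unfolding bad_proj_def by (auto simp: not_le intro: less_imp_le)
      then show "\<bar>w g q p * (proj_prod D d s q p - q \<bullet> p)\<bar> \<le> w g q p * \<eta>"
        unfolding abs_mult using w_nonneg[of g q p] by (simp add: mult_left_mono)
    qed
    then show "\<bar>\<Sum>p\<in>P. w g q p * (proj_prod D d s q p - q \<bullet> p)\<bar> \<le> \<eta>"
      by (simp add: sum_distrib_right[symmetric] sum_w[OF g])
  qed
  finally show ?thesis .
qed

lemma integrable_w:
  assumes "q \<in> Q" "p \<in> P"
  shows "integrable (gauss_space k d) (\<lambda>g. w g q p)"
  using assms w_le_1 w_nonneg
  by (intro G.integrable_const_bound[where B = 1] AE_I2 borel_measurable_w) auto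

lemma integrable_estimate: "integrable (gauss_space k d \<Otimes>\<^sub>M sign_space D d) estimate"
  unfolding estimate_def[abs_def]
  by (intro integrable_divide Bochner_Integration.integrable_sum GS.integrable_product_function
      integrable_w integrable_proj_prod)

lemma integrable_part_estimate: "integrable (gauss_space k d) part_estimate"
  unfolding part_estimate_def[abs_def]
  by (intro integrable_divide Bochner_Integration.integrable_sum integrable_mult_left integrable_w)

text \<open>The projection is unbiased on every pair and independent of the weights; its tails
  therefore do not enter the expectation.\<close>

lemma expectation_estimate:
  "(\<integral>x. estimate x \<partial>(gauss_space k d \<Otimes>\<^sub>M sign_space D d)) = (\<integral>g. part_estimate g \<partial>gauss_space k d)"
proof -
  let ?N = "gauss_space k d \<Otimes>\<^sub>M sign_space D d"
  note int = GS.integrable_product_function[OF integrable_w integrable_proj_prod]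
  have "(\<integral>x. estimate x \<partial>?N) =
      (\<integral>x. (\<Sum>q\<in>Q. \<Sum>p\<in>P. w (fst x) q p * proj_prod D d (snd x) q p) \<partial>?N) / real (card Q)"
    unfolding estimate_def[abs_def] by (rule integral_divide_zero)
  also have "(\<integral>x. (\<Sum>q\<in>Q. \<Sum>p\<in>P. w (fst x) q p * proj_prod D d (snd x) q p) \<partial>?N) =
      (\<Sum>q\<in>Q. \<integral>x. (\<Sum>p\<in>P. w (fst x) q p * proj_prod D d (snd x) q p) \<partial>?N)"
    by (intro Bochner_Integration.integral_sum Bochner_Integration.integrable_sum int)
  also have "\<dots> = (\<Sum>q\<in>Q. \<Sum>p\<in>P. \<integral>x. w (fst x) q p * proj_prod D d (snd x) q p \<partial>?N)"
    by (intro sum.cong refl Bochner_Integration.integral_sum int)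
  also have "\<dots> = (\<Sum>q\<in>Q. \<Sum>p\<in>P. (\<integral>g. w g q p \<partial>gauss_space k d) * (q \<bullet> p))"
    by (intro sum.cong refl)
      (simp add: GS.integral_product_function[OF integrable_w integrable_proj_prod] expectation_proj_prod)
  also have "(\<Sum>q\<in>Q. \<Sum>p\<in>P. (\<integral>g. w g q p \<partial>gauss_space k d) * (q \<bullet> p)) / real (card Q) =
      (\<integral>g. part_estimate g \<partial>gauss_space k d)"
    unfolding part_estimate_def[abs_def]
    by (simp add: Bochner_Integration.integral_sum integrable_w cong: sum.cong)
  finally show ?thesis .
qed

text \<open>The upper bound holds for every partition. For the lower bound, a bad partition loses at
  most 2, because both the weighted average and the normalized Chamfer similarity lie between -1 and
  1.\<close>

lemma expectation_estimate_bounds: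
  "(\<integral>x. estimate x \<partial>(gauss_space k d \<Otimes>\<^sub>M sign_space D d)) \<le> nchamfer Q P"
  "nchamfer Q P - 2 * pi * \<eta> - 2 * measure (gauss_space k d) (bad_part \<eta>) \<le>
    (\<integral>x. estimate x \<partial>(gauss_space k d \<Otimes>\<^sub>M sign_space D d))" if "0 \<le> \<eta>"
proof -
  let ?G = "gauss_space k d" and ?c = "nchamfer Q P - 2 * pi * \<eta>"
  have "(\<integral>g. part_estimate g \<partial>?G) \<le> (\<integral>g. nchamfer Q P \<partial>?G)"
    by (intro integral_mono integrable_part_estimate part_estimate_le) auto
  then show "(\<integral>x. estimate x \<partial>(?G \<Otimes>\<^sub>M sign_space D d)) \<le> nchamfer Q P"
    unfolding expectation_estimate by (simp add: G.prob_space)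
  have int: "integrable ?G (indicator (bad_part \<eta>) :: _ \<Rightarrow> real)"
    using sets_bad_part by (simp add: less_top[symmetric])
  have "(\<integral>g. ?c - 2 * indicator (bad_part \<eta>) g \<partial>?G) \<le> (\<integral>g. part_estimate g \<partial>?G)"
  proof (rule integral_mono)
    fix g assume g: "g \<in> space ?G"
    show "?c - 2 * indicator (bad_part \<eta>) g \<le> part_estimate g"
    proof (cases "g \<in> bad_part \<eta>")
      case True
      have "0 \<le> 2 * pi * \<eta>" using that by simp
      with True nchamfer_le_1 abs_part_estimate_le[OF g] show ?thesis by simp
    next
      case False
      with part_estimate_ge[OF g False] show ?thesis by simp
    qed
  qed (use int integrable_part_estimate in auto)
  also have "(\<integral>g. ?c - 2 * indicator (bad_part \<eta>) g \<partial>?G) = ?c - 2 * measure ?G (bad_part \<eta>)"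
    using int sets_bad_part by (simp add: G.prob_space)
  finally show "?c - 2 * measure ?G (bad_part \<eta>) \<le> (\<integral>x. estimate x \<partial>(?G \<Otimes>\<^sub>M sign_space D d))"
    unfolding expectation_estimate .
qed

lemma estimate_high_probability:
  fixes \<eta> \<theta> \<epsilon> :: real
  assumes \<epsilon>: "2 * pi * \<eta> + \<theta> \<le> \<epsilon>" "0 \<le> \<eta>"
  defines "N \<equiv> gauss_space k d \<Otimes>\<^sub>M sign_space D d"
  defines "good \<equiv> {x \<in> space N. nchamfer Q P - \<epsilon> \<le> estimate x \<and> estimate x \<le> nchamfer Q P + \<epsilon>}"
  shows "good \<in> sets N"
    and "1 - measure (gauss_space k d) (bad_part \<eta>) - measure (sign_space D d) (bad_proj \<theta>) \<le> measure N good"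
proof -
  let ?G = "gauss_space k d" and ?S = "sign_space D d"
  \<comment> \<open>The two failure events are lifted to cylinders over the factors, so that their
    probabilities are unchanged and a union bound applies.\<close>
  let ?A = "bad_part \<eta> \<times> space ?S" and ?B = "space ?G \<times> bad_proj \<theta>"
  interpret N: prob_space N unfolding N_def by (rule GS.prob_space_axioms)
  note [measurable] = borel_measurable_integrable[OF integrable_estimate, folded N_def]
  show good: "good \<in> sets N" unfolding good_def by measurable
  have AB: "?A \<in> sets N" "?B \<in> sets N"
    unfolding N_def using sets_bad_part sets_bad_proj by (auto intro!: pair_measureI)
  have mA: "measure N ?A = measure ?G (bad_part \<eta>)"
    unfolding N_def using sets_bad_part
    by (simp add: measure_def S.emeasure_pair_measure_Times S.emeasure_space_1)
  have mB: "measure N ?B = measure ?S (bad_proj \<theta>)"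
    unfolding N_def using sets_bad_proj
    by (simp add: measure_def S.emeasure_pair_measure_Times G.emeasure_space_1)
  have sub: "space N - (?A \<union> ?B) \<subseteq> good"
  proof
    fix x assume x: "x \<in> space N - (?A \<union> ?B)"
    obtain g s where xgs: "x = (g, s)" by (cases x)
    from x have g: "g \<in> space ?G" "g \<notin> bad_part \<eta>" and s: "s \<in> space ?S" "s \<notin> bad_proj \<theta>"
      by (auto simp: xgs N_def space_pair_measure)
    have "0 \<le> 2 * pi * \<eta>" using \<epsilon>(2) by simp
    note bounds = this part_estimate_le[OF g(1)] part_estimate_ge[OF g] estimate_close[OF g(1) s] \<epsilon>(1)
    have "nchamfer Q P - \<epsilon> \<le> estimate x" unfolding xgs using bounds by linarith
    moreover have "estimate x \<le> nchamfer Q P + \<epsilon>" unfolding xgs using bounds by linarith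
    ultimately show "x \<in> good" using x by (simp add: good_def)
  qed
  have "1 - N.prob (?A \<union> ?B) = N.prob (space N - (?A \<union> ?B))"
    using AB by (intro N.prob_compl[symmetric]) auto
  also have "\<dots> \<le> N.prob good"
    by (rule N.finite_measure_mono[OF sub good])
  finally have "1 - N.prob (?A \<union> ?B) \<le> N.prob good" .
  moreover have "N.prob (?A \<union> ?B) \<le> N.prob ?A + N.prob ?B"
    by (rule measure_Un_le[OF AB])
  ultimately show "1 - measure ?G (bad_part \<eta>) - measure ?S (bad_proj \<theta>) \<le> N.prob good"
    unfolding mA mB by linarith
qed

lemma fde_estimate:
  assumes "\<omega> \<in> space (fde_space k D 1 d)"
  shows "1 / real (card Q) * (fde_query k D 1 d \<omega> Q \<bullet> fde_doc k D 1 d fill \<omega> P) = estimate (\<omega> 0)"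
proof -
  have "\<omega> 0 \<in> space (gauss_space k d \<Otimes>\<^sub>M sign_space D d)"
    using assms by (auto simp: fde_space_def space_PiM)
  then have "fst (\<omega> 0) \<in> space (gauss_space k d)" by (auto simp: space_pair_measure)
  then have "fill 0 (fst (\<omega> 0)) b \<in> P" if "b \<in> set (clusters k)" for b
    using fill_in_P that by blast
  from fde_scalar_prod[of Q d P k fill \<omega> D, OF finite_QP(1) carrier_QP(1) finite_QP(2) carrier_QP(2) this]
  show ?thesis by (simp add: estimate_def w_def)
qed

text \<open>With a single repetition the product has one factor, and evaluation at 0 transports the
  whole analysis to that factor.\<close>

lemma distr_fde_space:
  "distr (fde_space k D 1 d) (gauss_space k d \<Otimes>\<^sub>M sign_space D d) (\<lambda>\<omega>. \<omega> 0) =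
    gauss_space k d \<Otimes>\<^sub>M sign_space D d"
  unfolding fde_space_def by (rule distr_PiM_component) (auto intro: GS.prob_space_axioms)

lemma measurable_fde_component:
  "(\<lambda>\<omega>. \<omega> 0) \<in> measurable (fde_space k D 1 d) (gauss_space k d \<Otimes>\<^sub>M sign_space D d)"
  unfolding fde_space_def by (rule measurable_component_singleton) simp

lemma fde_approximation:
  fixes \<epsilon> \<delta> :: real
  defines "M \<equiv> fde_space k D 1 d"
    and "est \<equiv> (\<lambda>\<omega>. 1 / real (card Q) * (fde_query k D 1 d \<omega> Q \<bullet> fde_doc k D 1 d fill \<omega> P))"
    and "fail_part \<equiv> real (card Q) * real (card P) * (2 * exp (- 2 * real k * (\<epsilon> / 16)\<^sup>2))"
    and "fail_proj \<equiv> real (card Q) * real (card P) * (2 * exp (- real D * (\<epsilon> / 2)\<^sup>2 / 8192))"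
  assumes \<epsilon>: "0 < \<epsilon>" "\<epsilon> \<le> 1" and fail: "fail_part \<le> \<epsilon> / 4" "fail_part + fail_proj \<le> \<delta>"
  shows "integrable M est"
    and "nchamfer Q P - \<epsilon> \<le> integral\<^sup>L M est" and "integral\<^sup>L M est \<le> nchamfer Q P + \<epsilon>"
    and "{\<omega> \<in> space M. nchamfer Q P - \<epsilon> \<le> est \<omega> \<and> est \<omega> \<le> nchamfer Q P + \<epsilon>} \<in> sets M"
    and "1 - \<delta> \<le> measure M {\<omega> \<in> space M. nchamfer Q P - \<epsilon> \<le> est \<omega> \<and> est \<omega> \<le> nchamfer Q P + \<epsilon>}"
proof -
  let ?N = "gauss_space k d \<Otimes>\<^sub>M sign_space D d"
  have est: "est \<omega> = estimate (\<omega> 0)" if "\<omega> \<in> space M" for \<omega>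
    using that unfolding M_def est_def by (rule fde_estimate)
  have X: "(\<lambda>\<omega>. \<omega> 0) \<in> measurable M ?N" unfolding M_def by (rule measurable_fde_component)
  have distr: "distr M ?N (\<lambda>\<omega>. \<omega> 0) = ?N" unfolding M_def by (rule distr_fde_space)
  have "integrable M (\<lambda>\<omega>. estimate (\<omega> 0))"
    using integrable_distr[OF X, of estimate] integrable_estimate by (simp add: distr)
  then show "integrable M est"
    by (subst Bochner_Integration.integrable_cong[OF refl est])
  have "integral\<^sup>L M est = (\<integral>\<omega>. estimate (\<omega> 0) \<partial>M)"
    by (rule Bochner_Integration.integral_cong[OF refl est])
  also have "\<dots> = (\<integral>x. estimate x \<partial>?N)"
    using integral_distr[OF X borel_measurable_integrable[OF integrable_estimate]] by (simp add: distr)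
  finally have E: "integral\<^sup>L M est = (\<integral>x. estimate x \<partial>?N)" .
  \<comment> \<open>This is the share of the partition. The other \<open>\<epsilon> / 2\<close> goes
    to the projection, or, in expectation, to twice the failure probability
    \<open>\<epsilon> / 4\<close>.\<close>
  have small: "2 * pi * (\<epsilon> / 16) \<le> \<epsilon> / 2"
    using mult_right_mono[of pi 4 \<epsilon>] pi_less_4 \<epsilon> by simp
  have fail_part: "measure (gauss_space k d) (bad_part (\<epsilon> / 16)) \<le> fail_part"
    unfolding fail_part_def using \<epsilon> by (intro measure_bad_part) simp
  have fail_proj: "measure (sign_space D d) (bad_proj (\<epsilon> / 2)) \<le> fail_proj"
    unfolding fail_proj_def using \<epsilon> by (intro measure_bad_proj) simp_all
  show "integral\<^sup>L M est \<le> nchamfer Q P + \<epsilon>"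
    using expectation_estimate_bounds(1)[of 0] \<epsilon> unfolding E by simp
  show "nchamfer Q P - \<epsilon> \<le> integral\<^sup>L M est"
    using expectation_estimate_bounds(2)[of "\<epsilon> / 16"] \<epsilon> fail(1) fail_part small unfolding E by linarith
  define good where "good = {x \<in> space ?N. nchamfer Q P - \<epsilon> \<le> estimate x \<and> estimate x \<le> nchamfer Q P + \<epsilon>}"
  have \<epsilon>': "2 * pi * (\<epsilon> / 16) + \<epsilon> / 2 \<le> \<epsilon>" using small by linarith
  have "0 \<le> \<epsilon> / 16" using \<epsilon> by simp
  note good = estimate_high_probability[OF \<epsilon>' this, folded good_def]
  have set: "{\<omega> \<in> space M. nchamfer Q P - \<epsilon> \<le> est \<omega> \<and> est \<omega> \<le> nchamfer Q P + \<epsilon>} = (\<lambda>\<omega>. \<omega> 0) -` good \<inter> space M"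
    using measurable_space[OF X] est unfolding good_def by auto
  show "{\<omega> \<in> space M. nchamfer Q P - \<epsilon> \<le> est \<omega> \<and> est \<omega> \<le> nchamfer Q P + \<epsilon>} \<in> sets M"
    unfolding set by (rule measurable_sets[OF X good(1)])
  have "measure M ((\<lambda>\<omega>. \<omega> 0) -` good \<inter> space M) = measure ?N good"
    using measure_distr[OF X good(1)] by (simp add: distr)
  then show "1 - \<delta> \<le> measure M {\<omega> \<in> space M. nchamfer Q P - \<epsilon> \<le> est \<omega> \<and> est \<omega> \<le> nchamfer Q P + \<epsilon>}"
    unfolding set using good(2) fail(2) fail_part fail_proj by linarith
qed

end

section \<open>Choice of the parameters and size of the encoding\<close>

lemma union_bound_le:
  fixes \<epsilon> \<delta> C c :: real and n1 n2 k :: nat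
  defines "m \<equiv> real (n1 + n2)"
  assumes \<epsilon>: "0 < \<epsilon>" "\<epsilon> \<le> 1" and \<delta>: "0 < \<delta>" "\<delta> \<le> 1" and n: "1 \<le> n1" "1 \<le> n2"
    and c: "0 < c" "3 * c \<le> C" and k: "C * (ln (m / (\<epsilon> * \<delta>)) / \<epsilon>\<^sup>2) \<le> real k"
  shows "real n1 * real n2 * (2 * exp (- (real k * \<epsilon>\<^sup>2 / c))) \<le> \<epsilon> * \<delta> / 4"
proof -
  define x where "x = \<epsilon> * \<delta>"
  have x: "0 < x" "x \<le> 1" using \<epsilon> \<delta> by (auto simp: x_def mult_le_one)
  have m: "2 \<le> m" using n by (simp add: m_def)
  have "1 \<le> m / x" using m x by (simp add: le_divide_eq)
  then have L: "0 \<le> ln (m / x)" by simp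
  \<comment> \<open>The factor 3 yields the third power of \<open>x / m\<close>: two powers of m pay
    for the number of pairs, at most \<open>m\<^sup>2 / 4\<close>, and the remaining one, with m at
    least 2, leaves the factor 1/4.\<close>
  have "3 * c * ln (m / x) \<le> C * ln (m / x)"
    using c L by (intro mult_right_mono)
  also have "\<dots> \<le> real k * \<epsilon>\<^sup>2"
    using k \<epsilon> by (simp add: x_def pos_divide_le_eq)
  finally have "3 * ln (m / x) \<le> real k * \<epsilon>\<^sup>2 / c"
    using c by (simp add: pos_le_divide_eq mult_ac)
  then have "exp (- (real k * \<epsilon>\<^sup>2 / c)) \<le> exp (- (3 * ln (m / x)))" by simp
  also have "\<dots> = inverse ((m / x) ^ 3)"
  proof -
    have "exp (3 * ln (m / x)) = exp (ln (m / x)) ^ 3"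
      using exp_of_nat_mult[of 3 "ln (m / x)"] by simp
    then show ?thesis using m x by (simp add: exp_minus)
  qed
  also have "\<dots> = x ^ 3 / m ^ 3" by (simp add: power_divide)
  finally have e: "exp (- (real k * \<epsilon>\<^sup>2 / c)) \<le> x ^ 3 / m ^ 3" .
  have "4 * (real n1 * real n2) \<le> m\<^sup>2"
    using zero_le_power2[of "real n1 - real n2"] by (simp add: m_def power2_eq_square algebra_simps)
  then have "real n1 * real n2 * (2 * exp (- (real k * \<epsilon>\<^sup>2 / c))) \<le> m\<^sup>2 / 4 * (2 * (x ^ 3 / m ^ 3))"
    using e by (intro mult_mono mult_left_mono) auto
  also have "\<dots> = x * (x\<^sup>2 / (2 * m))"
    using m by (simp add: power2_eq_square power3_eq_cube field_simps)
  also have "\<dots> \<le> x * (1 / 4)"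
    using x m by (intro mult_left_mono frac_le) (auto simp: power_le_one)
  finally show ?thesis by (simp add: x_def)
qed

lemma real_nat_ceiling_le_add_one: "0 \<le> x \<Longrightarrow> real (nat \<lceil>x\<rceil>) \<le> x + 1"
  using of_int_ceiling_le_add_one[of x] by simp

text \<open>The exponent is the logarithm of \<open>2 ^ k * D\<close> to base X. The crude bound
  \<open>ln D \<le> D\<close> suffices, since D has the same order as k.\<close>

lemma fde_dim_powr:
  fixes \<epsilon> X C1 C2 :: real
  assumes \<epsilon>: "0 < \<epsilon>" "\<epsilon> \<le> 1" and X: "2 \<le> X"
    and k: "real k \<le> C1 * (ln X / \<epsilon>\<^sup>2) + 1" and D: "0 < D" "real D \<le> C2 * (ln X / \<epsilon>\<^sup>2) + 1"
  shows "\<exists>e. \<bar>e\<bar> \<le> (C1 + C2 + 4) / \<epsilon>\<^sup>2 \<and> real (fde_dim k D 1) = X powr e"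
proof -
  define L where "L = ln X"
  have "ln 2 \<le> L" unfolding L_def using X by simp
  then have L: "1 / 2 \<le> L" using ln2_ge_two_thirds by linarith
  define e where "e = (real k * ln 2 + ln (real D)) / L"
  have lnD: "0 \<le> ln (real D)" "ln (real D) \<le> real D"
    using D(1) ln_bound[of "real D"] by auto
  have "real (fde_dim k D 1) = X powr e"
  proof -
    have "X powr e = exp (real k * ln 2 + ln (real D))"
      using X L by (simp add: powr_def e_def L_def)
    also have "\<dots> = 2 ^ k * real D"
      using D(1) by (simp add: exp_add exp_of_nat_mult)
    finally show ?thesis by (simp add: fde_dim_def)
  qed
  moreover have "\<bar>e\<bar> \<le> (C1 + C2 + 4) / \<epsilon>\<^sup>2"
  proof -
    have "real k * ln 2 \<le> real k * 1"
      using ln_2_less_1 by (intro mult_left_mono) auto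
    then have "real k * ln 2 + ln (real D) \<le> C1 * (L / \<epsilon>\<^sup>2) + C2 * (L / \<epsilon>\<^sup>2) + 2"
      using k D(2) lnD(2) unfolding L_def by linarith
    then have "e \<le> (C1 * (L / \<epsilon>\<^sup>2) + C2 * (L / \<epsilon>\<^sup>2) + 2) / L"
      unfolding e_def using L by (intro divide_right_mono) auto
    also have "\<dots> = (C1 + C2) / \<epsilon>\<^sup>2 + 2 / L"
      using L by (simp add: add_divide_distrib)
    \<comment> \<open>The 2 collects the two roundings up; since X is at least 2, its logarithm
      exceeds 1/2, and the constant 4 is absorbed into
      \<open>4 / \<epsilon>\<^sup>2\<close>.\<close>
    also have "2 / L \<le> 4"
      using L by (simp add: divide_le_eq)
    also have "4 \<le> 4 / \<epsilon>\<^sup>2"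
      using \<epsilon> by (simp add: le_divide_eq power_le_one)
    finally have "e \<le> (C1 + C2 + 4) / \<epsilon>\<^sup>2" by (simp add: add_divide_distrib)
    moreover have "0 \<le> e" unfolding e_def using L lnD by (intro divide_nonneg_nonneg) auto
    ultimately show ?thesis by simp
  qed
  ultimately show ?thesis by blast
qed

text \<open>A sufficiently large absolute constant means any \<open>C1\<close> and \<open>C2\<close>
  above a threshold \<open>C0\<close> fixed before all other data; the constant \<open>C3\<close> in
  the exponent of the dimension depends on these two only.\<close>

theorem theorem2p1:
  shows "\<exists>C0>0. \<forall>C1\<ge>C0. \<forall>C2\<ge>C0. \<exists>C3::real. \<forall>(d::nat) (\<epsilon>::real) (\<delta>::real) Q P fill.
    0 < \<epsilon> \<longrightarrow> \<epsilon> \<le> 1 \<longrightarrow> 0 < \<delta> \<longrightarrow> \<delta> \<le> 1 \<longrightarrow> unit_vec_set d Q \<longrightarrow> unit_vec_set d P \<longrightarrow>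
    (let m = real (card Q + card P);
         k = nat \<lceil>C1 * (ln (m * inverse \<epsilon> * inverse \<delta>) / \<epsilon>\<^sup>2)\<rceil>;
         D = nat \<lceil>C2 * (1 / \<epsilon>\<^sup>2 * ln (m / (\<epsilon> * \<delta>)))\<rceil>;
         R = 1;
         M = fde_space k D R d;
         est = (\<lambda>\<omega>. 1 / real (card Q) * (fde_query k D R d \<omega> Q \<bullet> fde_doc k D R d fill \<omega> P))
     in (\<exists>e. \<bar>e\<bar> \<le> C3 / \<epsilon>\<^sup>2 \<and> real (fde_dim k D R) = (m / (\<epsilon> * \<delta>)) powr e) \<and>
        (tie_breaking k R d P fill \<longrightarrow>
           integrable M est \<and>
           nchamfer Q P - \<epsilon> \<le> integral\<^sup>L M est \<and> integral\<^sup>L M est \<le> nchamfer Q P + \<epsilon> \<and>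
           {\<omega> \<in> space M. nchamfer Q P - \<epsilon> \<le> est \<omega> \<and> est \<omega> \<le> nchamfer Q P + \<epsilon>} \<in> sets M \<and>
           measure M {\<omega> \<in> space M. nchamfer Q P - \<epsilon> \<le> est \<omega> \<and> est \<omega> \<le> nchamfer Q P + \<epsilon>}
             \<ge> 1 - \<delta>))"
proof (rule exI[of _ 98304], intro conjI allI impI)
  fix C1 C2 :: real
  \<comment> \<open>The threshold is \<open>3 * 32768\<close>, where \<open>32768 = 4 * 8192\<close>
    comes from the projection with error \<open>\<epsilon> / 2\<close>. It also covers the
    partition, which asks for \<open>3 * 128\<close>.\<close>
  assume C: "98304 \<le> C1" "98304 \<le> C2"
  show "\<exists>C3::real. \<forall>(d::nat) (\<epsilon>::real) (\<delta>::real) Q P fill.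
    0 < \<epsilon> \<longrightarrow> \<epsilon> \<le> 1 \<longrightarrow> 0 < \<delta> \<longrightarrow> \<delta> \<le> 1 \<longrightarrow> unit_vec_set d Q \<longrightarrow> unit_vec_set d P \<longrightarrow>
    (let m = real (card Q + card P);
         k = nat \<lceil>C1 * (ln (m * inverse \<epsilon> * inverse \<delta>) / \<epsilon>\<^sup>2)\<rceil>;
         D = nat \<lceil>C2 * (1 / \<epsilon>\<^sup>2 * ln (m / (\<epsilon> * \<delta>)))\<rceil>;
         R = 1;
         M = fde_space k D R d;
         est = (\<lambda>\<omega>. 1 / real (card Q) * (fde_query k D R d \<omega> Q \<bullet> fde_doc k D R d fill \<omega> P))
     in (\<exists>e. \<bar>e\<bar> \<le> C3 / \<epsilon>\<^sup>2 \<and> real (fde_dim k D R) = (m / (\<epsilon> * \<delta>)) powr e) \<and>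
        (tie_breaking k R d P fill \<longrightarrow>
           integrable M est \<and>
           nchamfer Q P - \<epsilon> \<le> integral\<^sup>L M est \<and> integral\<^sup>L M est \<le> nchamfer Q P + \<epsilon> \<and>
           {\<omega> \<in> space M. nchamfer Q P - \<epsilon> \<le> est \<omega> \<and> est \<omega> \<le> nchamfer Q P + \<epsilon>} \<in> sets M \<and>
           measure M {\<omega> \<in> space M. nchamfer Q P - \<epsilon> \<le> est \<omega> \<and> est \<omega> \<le> nchamfer Q P + \<epsilon>}
             \<ge> 1 - \<delta>))"
  proof (rule exI[of _ "C1 + C2 + 4"], intro allI impI)
    fix d :: nat and \<epsilon> \<delta> :: real and Q P :: "real vec set" and fill
    assume \<epsilon>: "0 < \<epsilon>" "\<epsilon> \<le> 1" and \<delta>: "0 < \<delta>" "\<delta> \<le> 1"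
      and Q: "unit_vec_set d Q" and P: "unit_vec_set d P"
    define X where "X = real (card Q + card P) / (\<epsilon> * \<delta>)"
    have X': "real (card Q + card P) * inverse \<epsilon> * inverse \<delta> = X"
      by (simp add: X_def divide_inverse mult.assoc)
    define k where "k = nat \<lceil>C1 * (ln X / \<epsilon>\<^sup>2)\<rceil>"
    define D where "D = nat \<lceil>C2 * (1 / \<epsilon>\<^sup>2 * ln X)\<rceil>"
    have D': "D = nat \<lceil>C2 * (ln X / \<epsilon>\<^sup>2)\<rceil>" by (simp add: D_def)
    have n: "1 \<le> card Q" "1 \<le> card P"
      using Q P by (simp_all add: unit_vec_set_def Suc_le_eq card_gt_0_iff)
    \<comment> \<open>At least two vectors and \<open>\<epsilon> * \<delta> \<le> 1\<close> keep the
      logarithm positive, so that k and D are positive after rounding.\<close>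
    have X: "2 \<le> X"
    proof -
      have "2 * (\<epsilon> * \<delta>) \<le> 2 * 1"
        using \<epsilon> \<delta> by (intro mult_left_mono mult_le_one) auto
      also have "\<dots> \<le> real (card Q + card P)" using n by simp
      finally show ?thesis using \<epsilon> \<delta> by (simp add: X_def le_divide_eq)
    qed
    then have L: "0 < ln X / \<epsilon>\<^sup>2" using \<epsilon> by simp
    have "0 < C1" "0 < C2" using C by simp_all
    then have x: "0 < C1 * (ln X / \<epsilon>\<^sup>2)" "0 < C2 * (ln X / \<epsilon>\<^sup>2)"
      using L by (simp_all only: mult_pos_pos)
    have k: "0 < k" "C1 * (ln X / \<epsilon>\<^sup>2) \<le> real k" "real k \<le> C1 * (ln X / \<epsilon>\<^sup>2) + 1"
      using x(1) real_nat_ceiling_le_add_one[OF less_imp_le[OF x(1)]]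
      unfolding k_def by (simp_all only: zero_less_nat_eq zero_less_ceiling real_nat_ceiling_ge)
    have D: "0 < D" "C2 * (ln X / \<epsilon>\<^sup>2) \<le> real D" "real D \<le> C2 * (ln X / \<epsilon>\<^sup>2) + 1"
      using x(2) real_nat_ceiling_le_add_one[OF less_imp_le[OF x(2)]]
      unfolding D' by (simp_all only: zero_less_nat_eq zero_less_ceiling real_nat_ceiling_ge)
    have dim: "\<exists>e. \<bar>e\<bar> \<le> (C1 + C2 + 4) / \<epsilon>\<^sup>2 \<and> real (fde_dim k D 1) = X powr e"
      by (rule fde_dim_powr[OF \<epsilon> X k(3) D(1,3)])
    define fail_part where "fail_part = real (card Q) * real (card P) * (2 * exp (- 2 * real k * (\<epsilon> / 16)\<^sup>2))"
    define fail_proj where "fail_proj = real (card Q) * real (card P) * (2 * exp (- real D * (\<epsilon> / 2)\<^sup>2 / 8192))"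
    have "fail_part = real (card Q) * real (card P) * (2 * exp (- (real k * \<epsilon>\<^sup>2 / 128)))"
      by (simp add: fail_part_def power_divide)
    also have "\<dots> \<le> \<epsilon> * \<delta> / 4"
      using C(1) k(2) unfolding X_def by (intro union_bound_le[OF \<epsilon> \<delta> n, of 128 C1]) auto
    finally have fail_part: "fail_part \<le> \<epsilon> * \<delta> / 4" .
    have "fail_proj = real (card Q) * real (card P) * (2 * exp (- (real D * \<epsilon>\<^sup>2 / 32768)))"
      by (simp add: fail_proj_def power_divide)
    also have "\<dots> \<le> \<epsilon> * \<delta> / 4"
      using C(2) D(2) unfolding X_def by (intro union_bound_le[OF \<epsilon> \<delta> n, of 32768 C2]) auto
    finally have fail_proj: "fail_proj \<le> \<epsilon> * \<delta> / 4" .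
    \<comment> \<open>The common bound \<open>\<epsilon> * \<delta> / 4\<close> serves twice: it is
      small against \<epsilon> for the expectation and, doubled, against \<delta> for the
      probability.\<close>
    have "\<epsilon> * \<delta> \<le> \<epsilon>" using \<epsilon> \<delta> by (simp add: mult_left_le)
    with fail_part have fail1: "fail_part \<le> \<epsilon> / 4" by linarith
    have "\<epsilon> * \<delta> \<le> \<delta>" using \<epsilon> \<delta> by (simp add: mult_left_le_one_le)
    with fail_part fail_proj \<delta> have fail2: "fail_part + fail_proj \<le> \<delta>" by linarith
    let ?M = "fde_space k D 1 d"
    let ?est = "\<lambda>\<omega>. 1 / real (card Q) * (fde_query k D 1 d \<omega> Q \<bullet> fde_doc k D 1 d fill \<omega> P)"
    let ?good = "{\<omega> \<in> space ?M. nchamfer Q P - \<epsilon> \<le> ?est \<omega> \<and> ?est \<omega> \<le> nchamfer Q P + \<epsilon>}"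
    have approx: "integrable ?M ?est \<and> nchamfer Q P - \<epsilon> \<le> integral\<^sup>L ?M ?est \<and>
        integral\<^sup>L ?M ?est \<le> nchamfer Q P + \<epsilon> \<and> ?good \<in> sets ?M \<and> 1 - \<delta> \<le> measure ?M ?good"
      if "tie_breaking k 1 d P fill"
    proof -
      interpret fde_setup k D d Q P fill
        using Q P k(1) D(1) that by unfold_locales
      show ?thesis
        using fde_approximation[OF \<epsilon> fail1[unfolded fail_part_def] fail2[unfolded fail_part_def fail_proj_def]] by (intro conjI)
    qed
    show "let m = real (card Q + card P);
         k = nat \<lceil>C1 * (ln (m * inverse \<epsilon> * inverse \<delta>) / \<epsilon>\<^sup>2)\<rceil>;
         D = nat \<lceil>C2 * (1 / \<epsilon>\<^sup>2 * ln (m / (\<epsilon> * \<delta>)))\<rceil>;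
         R = 1;
         M = fde_space k D R d;
         est = (\<lambda>\<omega>. 1 / real (card Q) * (fde_query k D R d \<omega> Q \<bullet> fde_doc k D R d fill \<omega> P))
     in (\<exists>e. \<bar>e\<bar> \<le> (C1 + C2 + 4) / \<epsilon>\<^sup>2 \<and> real (fde_dim k D R) = (m / (\<epsilon> * \<delta>)) powr e) \<and>
        (tie_breaking k R d P fill \<longrightarrow>
           integrable M est \<and>
           nchamfer Q P - \<epsilon> \<le> integral\<^sup>L M est \<and> integral\<^sup>L M est \<le> nchamfer Q P + \<epsilon> \<and>
           {\<omega> \<in> space M. nchamfer Q P - \<epsilon> \<le> est \<omega> \<and> est \<omega> \<le> nchamfer Q P + \<epsilon>} \<in> sets M \<and>
           measure M {\<omega> \<in> space M. nchamfer Q P - \<epsilon> \<le> est \<omega> \<and> est \<omega> \<le> nchamfer Q P + \<epsilon>}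
             \<ge> 1 - \<delta>)"
      unfolding Let_def X' X_def[symmetric] k_def[symmetric] D_def[symmetric]
      using dim approx by blast
  qed
qed simp

end
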